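(* Let $0>s_1>s_2>\dots$ be the negative roots of $\psi(s)=\psi(1)$. For every fixed integer $N\ge0$, as $n\to\infty$, \[ \mathbb{E}[L_n]=\frac{3}{\pi^2}h_{n-1}^2+\frac{\zeta(3)}{\zeta(2)^2}h_{n-1}+\frac{\zeta(3)^2}{\zeta(2)^3}+\frac1{10}-\frac{3}{\pi^2}\psi'(n)+\sum_{i=1}^N\frac{\Gamma(|s_i|+1)}{(|s_i|+1)\psi'(s_i)}\,\frac{\Gamma(n)}{\Gamma(n+|s_i|+1)}+O\big(n^{-1-|s_{N+1}|}\big). \] In particular, \[ \mathbb{E}[L_n]=\frac{3}{\pi^2}\log^2 n+\Big(\frac{\zeta(3)}{\zeta(2)^2}+\frac{\gamma}{\zeta(2)}\Big)\log n+b_0+O\Big(\frac{\log n}{n}\Big),\quad b_0=\frac{3\gamma^2}{\pi^2}+\frac{\zeta(3)}{\zeta(2)^2}\gamma+\frac{\zeta(3)^2}{\zeta(2)^3}+\frac1{10}. \]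
   Context: For $m\ge2$ let $h_{m-1}=\sum_{i=1}^{m-1}1/i$. The random tree $\mathrm{DTCS}(n)$ is built by recursively splitting the set of $n$ leaves: a block of size $m\ge2$ splits into two blocks of sizes $i$ and $m-i$ with probability $q(m,i)=\frac{m}{2h_{m-1}}\cdot\frac{1}{i(m-i)}$, $1\le i\le m-1$; blocks of size 1 are leaves; each edge has length 1. $L_n$ is the hop-height (number of edges from the root) of a uniformly random leaf of $\mathrm{DTCS}(n)$; equivalently, $L_n$ is the number of steps until absorption at 1 of the discrete-time Markov chain on $\{1,2,\dots\}$ started at $n$ with transition probabilities $\frac{1}{h_{m-1}}\cdot\frac{1}{m-i}$ from $m$ to $i$, $1\le i\le m-1$. $\psi=\Gamma'/\Gamma$ is the digamma function, $\gamma$ Euler's constant, $\zeta$ the Riemann zeta function. All roots of $\psi(s)=\psi(1)$ are real: $s_0=1$ and one root $s_i\in(-i,-(i-1))$ for each $i\ge1$. *)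

theory Defs
  imports "HOL-Analysis.Analysis" "HOL-Library.Landau_Symbols"
begin

definition zeta_nat :: "nat \<Rightarrow> real" where
  "zeta_nat k = (\<Sum>m. 1 / real (Suc m) ^ k)"

definition trans_prob :: "nat \<Rightarrow> nat \<Rightarrow> real" where
  "trans_prob m i = (if 1 \<le> i \<and> i < m then (1 / harm (m - 1)) * (1 / real (m - i)) else 0)"

text \<open>hop_dist n k = P(L_n = k): probability that the chain started at n is absorbed
  at 1 after exactly k steps (state 1 is absorbing; L_1 = 0).\<close>
fun hop_dist :: "nat \<Rightarrow> nat \<Rightarrow> real" where
  "hop_dist m 0 = (if m = 1 then 1 else 0)"
| "hop_dist m (Suc k) = (if m \<le> 1 then 0 else (\<Sum>i = 1..m - 1. trans_prob m i * hop_dist i k))"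

definition exp_L :: "nat \<Rightarrow> real" where
  "exp_L n = (\<Sum>k. real k * hop_dist n k)"

definition neg_root :: "nat \<Rightarrow> real" where
  "neg_root i = (THE s. - real i < s \<and> s < - (real i - 1) \<and> Digamma s = Digamma (1::real))"

end

theory Submission
  imports Defs "HOL-Complex_Analysis.Complex_Analysis" "HOL-Real_Asymp.Real_Asymp"
begin

text \<open>The expected hop-height has the closed form
  \<open>exp_L (m + 1) = (\<Sum>j=1..m. (-1)^(j+1) (m choose j) / (j harm j))\<close>. Since
  \<open>harm j = \<psi>(j + 1) - \<psi>(1)\<close>, this alternating sum is a Noerlund-Rice sum: it is the sum of the
  residues at \<open>1, \<dots>, m\<close> of \<open>m! / (\<Prod>k\<le>m. (k - s)) / (s (\<psi>(s + 1) - \<psi>(1)))\<close>. The other poles of this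
  function are a triple pole at \<open>0\<close>, yielding the polynomial in \<open>harm m\<close>, and simple poles at
  \<open>s\<^sub>i - 1\<close>, which yield the Gamma quotients. Because the imaginary part of \<open>\<psi>\<close> has the sign of the
  imaginary part of its argument, \<open>\<psi>(s + 1) - \<psi>(1)\<close> is bounded away from \<open>0\<close> on large rectangles
  whose left side is the line \<open>Re s = -(K + 1)\<close>, and the integral over that line is \<open>O(m^-(K+1))\<close>.\<close>

section \<open>The closed form of the expected hop-height\<close>

text \<open>The left side is placed on Re s = -(K + 1) because there s + 1 runs along the vertical
  line through the pole -K of psi. The roots lie strictly between consecutive poles, so such a line
  never meets one, wherever in its unit interval a root sits; and near a pole \<open>Psi\<close> is
  large, so 1 / \<open>Psi\<close> is at most 2 on the whole line. The price is that the integrand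
  must be regular at the poles of psi, which is why \<open>inv_Psi\<close> is a quotient of entire
  functions. On the other three sides m is fixed and only their distance grows. The decay comes from
  the kernel and the factor 1 / s, so a constant lower bound for \<open>Psi\<close> suffices. What
  remains is an inequality with explicit constants valid for every m and K; all asymptotics are read
  off from it afterwards.\<close>

lemma harm_real_nonzero: "n > 0 \<Longrightarrow> harm n \<noteq> (0 :: real)"
  by (metis harm_pos less_irrefl)

text \<open>Coefficient of x^m in the product of x^j / (1 - x)^(j + 1) and -log (1 - x). The weights
  1 / (m - l) are those of the jumps of the chain, so this identity is what makes the binomials
  eigenfunctions.\<close>

lemma binomial_convolution_harm:
  "(\<Sum>l<m. real (l choose j) / real (m - l)) = (harm m - harm j) * real (m choose j)"
proof -
  \<comment> \<open>Indexed by the jump size d, so that Pascal's rule can act on the upper index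
    \<open>Suc m - d\<close>.\<close>
  have *: "(\<Sum>d=1..m. real ((m - d) choose j) / real d) = (harm m - harm j) * real (m choose j)" for m
  proof (induction m arbitrary: j)
    case 0
    then show ?case by (cases j) (auto simp: harm_def)
  next
    case (Suc m)
    show ?case
    proof (cases j)
      case 0
      then show ?thesis by (simp add: harm_def inverse_eq_divide)
    next
      case (Suc i)
      have "(\<Sum>d=1..Suc m. real ((Suc m - d) choose j) / real d)
          = (\<Sum>d=1..m. real ((Suc m - d) choose j) / real d)"
        using Suc by simp
      also have "\<dots> = (\<Sum>d=1..m. real ((m - d) choose i) / real d + real ((m - d) choose Suc i) / real d)"
        by (intro sum.cong) (auto simp: Suc Suc_diff_le add_divide_distrib)
      also have "\<dots> = (harm m - harm i) * real (m choose i) + (harm m - harm (Suc i)) * real (m choose Suc i)"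
        by (simp only: sum.distrib Suc.IH)
      also have "\<dots> = (harm (Suc m) - harm (Suc i)) * real (Suc m choose Suc i)"
      proof -
        have h: "(harm (Suc k) :: real) = harm k + 1 / real (Suc k)" for k
          by (simp add: harm_Suc inverse_eq_divide)
        have "real (Suc i) * real (Suc m choose Suc i) = real (Suc m) * real (m choose i)"
          by (metis Suc_times_binomial_eq of_nat_mult mult.commute)
        then have "real (Suc m choose Suc i) / real (Suc m) = real (m choose i) / real (Suc i)"
          by (simp add: field_simps)
        moreover have "(harm (Suc m) - harm (Suc i)) * real (Suc m choose Suc i)
          = (harm m - harm (Suc i)) * (real (m choose i) + real (m choose Suc i)) 
            + real (Suc m choose Suc i) / real (Suc m)"
          by (simp add: h[of m] ring_distribs add_divide_distrib)
        ultimately show ?thesis by (simp add: h[of i] ring_distribs)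
      qed
      finally show ?thesis using Suc by simp
    qed
  qed
  have "(\<Sum>l<m. real (l choose j) / real (m - l)) = (\<Sum>d=1..m. real ((m - d) choose j) / real d)"
    by (rule sum.reindex_bij_witness[of _ "\<lambda>d. m - d" "\<lambda>l. m - l"]) auto
  with * show ?thesis by simp
qed

text \<open>The increment from m to m + 1 is 1 / (m + 1) times an alternating sum of binomials
  without the term j = 0; that sum is 1 because the full alternating row sum vanishes.\<close>

lemma sum_alternating_binomial_harm:
  "(\<Sum>j=1..m. (-1) ^ (j + 1) * real (m choose j) / real j) = harm m"
proof (induction m)
  case 0
  then show ?case by (simp add: harm_def)
next
  case (Suc m)
  have "(\<Sum>j=1..Suc m. (-1) ^ (j + 1) * real (Suc m choose j) / real j)
      = (\<Sum>j=1..Suc m. (-1) ^ (j + 1) * real (m choose j) / real j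
           + (-1) ^ (j + 1) * real (Suc m choose j) / real (Suc m))"
  proof (intro sum.cong refl)
    fix j assume "j \<in> {1..Suc m}"
    then obtain i where j: "j = Suc i" by (cases j) auto
    have "real (Suc i) * real (Suc m choose Suc i) = real (Suc m) * real (m choose i)"
      by (metis Suc_times_binomial_eq of_nat_mult mult.commute)
    then have "real (Suc m choose Suc i) / real (Suc m) = real (m choose i) / real (Suc i)"
      by (simp add: field_simps)
    then have "real (Suc m choose Suc i) / real (Suc i)
        = real (m choose Suc i) / real (Suc i) + real (Suc m choose Suc i) / real (Suc m)"
      by (simp add: add_divide_distrib)
    then show "(-1) ^ (j + 1) * real (Suc m choose j) / real j = (-1) ^ (j + 1) * real (m choose j) / real j
           + (-1) ^ (j + 1) * real (Suc m choose j) / real (Suc m)"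
      unfolding j by (metis distrib_left times_divide_eq_right)
  qed
  also have "\<dots> = harm m + (\<Sum>j=1..Suc m. (-1) ^ (j + 1) * real (Suc m choose j)) / real (Suc m)"
  proof -
    have "(\<Sum>j=1..Suc m. (-1) ^ (j + 1) * real (m choose j) / real j)
        = (\<Sum>j=1..m. (-1) ^ (j + 1) * real (m choose j) / real j)"
      by simp
    then show ?thesis unfolding sum.distrib sum_divide_distrib[symmetric] by (simp only: Suc.IH)
  qed
  also have "(\<Sum>j=1..Suc m. (-1) ^ (j + 1) * real (Suc m choose j)) = 1"
  proof -
    have "(\<Sum>j\<le>Suc m. (-1) ^ j * real (Suc m choose j)) = 0"
      by (rule choose_alternating_sum) simp
    also have "{..Suc m} = insert 0 {1..Suc m}" by auto
    finally have "1 + (\<Sum>j=1..Suc m. (-1) ^ j * real (Suc m choose j)) = 0"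
      by (subst (asm) sum.insert) auto
    then show ?thesis by (simp only: power_add power_one_right mult_minus1_right mult_minus_left sum_negf)
  qed
  finally show ?case by (simp add: harm_Suc inverse_eq_divide)
qed

text \<open>The chain strictly decreases, so at most n - 1 steps are possible. This turns the series
  in \<open>exp_L\<close> into a finite sum and removes all questions of summability.\<close>

lemma hop_dist_eq_0: "n \<le> k \<Longrightarrow> hop_dist n k = 0"
proof (induction k arbitrary: n)
  case (Suc k)
  then show ?case by (auto intro!: sum.neutral)
qed auto

lemma trans_prob_sum: "n \<ge> 2 \<Longrightarrow> (\<Sum>i=1..n-1. trans_prob n i) = 1"
proof -
  assume n: "n \<ge> 2"
  have "(\<Sum>i=1..n-1. trans_prob n i) = (\<Sum>i=1..n-1. (1 / real (n - i)) / harm (n - 1))"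
    by (intro sum.cong) (auto simp: trans_prob_def)
  also have "\<dots> = (\<Sum>i=1..n-1. 1 / real (n - i)) / harm (n - 1)"
    by (simp add: sum_divide_distrib)
  also have "(\<Sum>i=1..n-1. 1 / real (n - i)) = (\<Sum>i=1..n-1. 1 / real i)"
    by (rule sum.reindex_bij_witness[of _ "\<lambda>d. n - d" "\<lambda>l. n - l"]) auto
  also have "\<dots> = harm (n - 1)" by (simp add: harm_def inverse_eq_divide)
  also have "harm (n - 1) / harm (n - 1) = (1::real)"
    using n by (intro divide_self harm_real_nonzero) auto
  finally show ?thesis .
qed

text \<open>Absorption is certain. This supplies the summand 1 in the recursion
  \<open>exp_L_rec\<close>.\<close>

lemma hop_dist_sum: "n \<ge> 1 \<Longrightarrow> n \<le> M \<Longrightarrow> (\<Sum>k<M. hop_dist n k) = 1"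
proof (induction n arbitrary: M rule: less_induct)
  case (less n)
  show ?case
  proof (cases "n = 1")
    case True
    then have "(\<Sum>k<M. hop_dist n k) = (\<Sum>k\<in>{0}. hop_dist n k)"
      using less.prems by (intro sum.mono_neutral_right) (auto simp: hop_dist_eq_0)
    with True show ?thesis by simp
  next
    case False
    then have n: "n \<ge> 2" using less.prems by auto
    obtain L where L: "M = Suc L" using less.prems by (cases M) auto
    have "(\<Sum>k<M. hop_dist n k) = (\<Sum>k<L. \<Sum>i=1..n-1. trans_prob n i * hop_dist i k)"
      unfolding L sum.lessThan_Suc_shift using n by simp
    also have "\<dots> = (\<Sum>i=1..n-1. trans_prob n i * (\<Sum>k<L. hop_dist i k))"
      by (subst sum.swap) (simp add: sum_distrib_left)
    also have "\<dots> = (\<Sum>i=1..n-1. trans_prob n i * 1)"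
      using less n L by (intro sum.cong refl arg_cong2[where f = "(*)"] less.IH) auto
    also have "\<dots> = 1" using trans_prob_sum[OF n] by simp
    finally show ?thesis .
  qed
qed

lemma exp_L_finite: "n \<le> M \<Longrightarrow> exp_L n = (\<Sum>k<M. real k * hop_dist n k)"
  unfolding exp_L_def by (rule suminf_finite) (auto simp: hop_dist_eq_0)

lemma exp_L_rec:
  assumes n: "n \<ge> 2"
  shows "exp_L n = 1 + (\<Sum>i=1..n-1. trans_prob n i * exp_L i)"
proof -
  \<comment> \<open>With the cut-off \<open>Suc n\<close>, splitting off the first step leaves the
    range k < n, which is long enough for every state i < n.\<close>
  have "exp_L n = (\<Sum>k<Suc n. real k * hop_dist n k)" by (rule exp_L_finite) simp
  also have "\<dots> = (\<Sum>k<n. real (Suc k) * (\<Sum>i=1..n-1. trans_prob n i * hop_dist i k))"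
    unfolding sum.lessThan_Suc_shift using n by simp
  also have "\<dots> = (\<Sum>i=1..n-1. trans_prob n i * (\<Sum>k<n. real (Suc k) * hop_dist i k))"
    unfolding sum_distrib_left by (subst sum.swap) (simp only: mult_ac)
  also have "\<dots> = (\<Sum>i=1..n-1. trans_prob n i * (1 + exp_L i))"
  proof (intro sum.cong refl arg_cong2[where f = "(*)"])
    fix i assume i: "i \<in> {1..n-1}"
    then have "(\<Sum>k<n. hop_dist i k) = 1" by (intro hop_dist_sum) auto
    moreover have "exp_L i = (\<Sum>k<n. real k * hop_dist i k)" using i by (intro exp_L_finite) auto
    ultimately show "(\<Sum>k<n. real (Suc k) * hop_dist i k) = 1 + exp_L i"
      by (simp add: ring_distribs sum.distrib)
  qed
  also have "\<dots> = 1 + (\<Sum>i=1..n-1. trans_prob n i * exp_L i)"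
    by (simp add: ring_distribs sum.distrib trans_prob_sum[OF n] del: One_nat_def)
  finally show ?thesis .
qed

text \<open>The binomial functions \<open>n \<mapsto> (n - 1 choose j)\<close> are eigenfunctions, with eigenvalue
  \<open>harm j\<close>, of the generator of the continuous-time chain that leaves \<open>n\<close> at rate
  \<open>harm (n - 1)\<close>; so the recursion is solved by expanding \<open>harm (n - 1)\<close> in them.\<close>

theorem exp_L_eq:
  "exp_L (Suc m) = (\<Sum>j=1..m. (-1) ^ (j + 1) * real (m choose j) / (real j * harm j))"
proof (induction m rule: less_induct)
  case (less m)
  define x where "x m = (\<Sum>j=1..m. (-1) ^ (j + 1) * real (m choose j) / (real j * harm j) :: real)" for m
  show ?case
  proof (cases "m = 0")
    case True
    have "exp_L 1 = 0" by (subst exp_L_finite[of 1 1]) auto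
    with True show ?thesis by simp
  next
    case False
    have hm: "harm m \<noteq> (0::real)" using False by (intro harm_real_nonzero) auto
    \<comment> \<open>The added terms contain vanishing binomials; a range independent of l allows
      the two sums to be swapped.\<close>
    have ext: "x l = (\<Sum>j=1..m. (-1) ^ (j + 1) * real (l choose j) / (real j * harm j))" if "l \<le> m" for l
      unfolding x_def using that by (intro sum.mono_neutral_left) auto
    have "exp_L (Suc m) = 1 + (\<Sum>i=1..m. trans_prob (Suc m) i * exp_L i)"
      using exp_L_rec[of "Suc m"] False by simp
    also have "(\<Sum>i=1..m. trans_prob (Suc m) i * exp_L i) = (\<Sum>l<m. trans_prob (Suc m) (Suc l) * exp_L (Suc l))"
      by (rule sum.reindex_bij_witness[of _ Suc "\<lambda>i. i - 1"]) auto
    also have "\<dots> = (\<Sum>l<m. x l / real (m - l)) / harm m"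
      unfolding sum_divide_distrib
    proof (intro sum.cong refl)
      fix l assume "l \<in> {..<m}"
      then show "trans_prob (Suc m) (Suc l) * exp_L (Suc l) = x l / real (m - l) / harm m"
        by (simp add: less.IH trans_prob_def x_def)
    qed
    also have "(\<Sum>l<m. x l / real (m - l)) = harm m * x m - harm m"
    proof -
      have "(\<Sum>l<m. x l / real (m - l))
          = (\<Sum>l<m. \<Sum>j=1..m. ((-1) ^ (j + 1) / (real j * harm j)) * (real (l choose j) / real (m - l)))"
        by (intro sum.cong refl) (simp add: ext sum_divide_distrib)
      also have "\<dots> = (\<Sum>j=1..m. ((-1) ^ (j + 1) / (real j * harm j)) * (\<Sum>l<m. real (l choose j) / real (m - l)))"
        unfolding sum_distrib_left by (rule sum.swap)
      also have "\<dots> = (\<Sum>j=1..m. harm m * ((-1) ^ (j + 1) * real (m choose j) / (real j * harm j))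
                         - (-1) ^ (j + 1) * real (m choose j) / real j)"
      proof (intro sum.cong refl)
        fix j assume "j \<in> {1..m}"
        then have "harm j \<noteq> (0::real)" by (intro harm_real_nonzero) auto
        then show "((-1) ^ (j + 1) / (real j * harm j)) * (\<Sum>l<m. real (l choose j) / real (m - l)) =
          harm m * ((-1) ^ (j + 1) * real (m choose j) / (real j * harm j)) - (-1) ^ (j + 1) * real (m choose j) / real j"
          using \<open>j \<in> {1..m}\<close> unfolding binomial_convolution_harm by (simp add: divide_simps) (simp add: algebra_simps)
      qed
      also have "\<dots> = harm m * x m - harm m"
        unfolding sum_subtractf sum_alternating_binomial_harm x_def sum_distrib_left ..
      finally show ?thesis .
    qed
    also have "1 + (harm m * x m - harm m) / harm m = x m"
      using hm by (simp add: diff_divide_distrib)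
    finally show ?thesis by (simp add: x_def)
  qed
qed

section \<open>Zeta values\<close>

lemma zeta_nat_sums: "k \<ge> 2 \<Longrightarrow> (\<lambda>n. 1 / real (Suc n) ^ k) sums zeta_nat k"
  using Polygamma_converges'[of "1 :: real" k] unfolding zeta_nat_def
  by (simp add: summable_sums inverse_eq_divide add.commute)

lemma zeta_nat_2: "zeta_nat 2 = pi\<^sup>2 / 6"
proof -
  have "(\<lambda>n. 1 / real (Suc n) ^ 2) sums (pi\<^sup>2 / 6)"
    using inverse_squares_sums by (simp add: add.commute)
  then show ?thesis using sums_unique2[OF zeta_nat_sums] by auto
qed

text \<open>Differentiate the reflection formula \<open>(\<psi>(1 - z) - \<psi>(z)) sin (\<pi> z) = \<pi> cos (\<pi> z)\<close>
  three times and evaluate at \<open>z = 1/2\<close>.\<close>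

lemma Polygamma_3_one_half: "Polygamma 3 (1 / 2 :: complex) = of_real (pi ^ 4)"
proof -
  define S where "S = {z. Re z > 0} \<inter> {z. Re z < 1}"
  define p where "p = complex_of_real pi"
  \<comment> \<open>\<open>P n\<close> is the n-th derivative of \<open>P 0\<close> on the strip,
    which contains no pole of either summand.\<close>
  define P where "P n z = (-1) ^ n * Polygamma n (1 - z) - Polygamma n z" for n and z :: complex
  define s where "s z = sin (p * z)" for z
  define c where "c z = cos (p * z)" for z
  have S: "open S" unfolding S_def by (intro open_Int open_halfspace_Re_gt open_halfspace_Re_lt)
  have nonpos: "z \<notin> \<int>\<^sub>\<le>\<^sub>0" "1 - z \<notin> \<int>\<^sub>\<le>\<^sub>0" if "z \<in> S" for z
  proof -
    have "Re w \<le> 0" if "w \<in> \<int>\<^sub>\<le>\<^sub>0" for w :: complex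
      using that by (auto elim!: nonpos_Ints_cases)
    from this[of z] this[of "1 - z"] show "z \<notin> \<int>\<^sub>\<le>\<^sub>0" "1 - z \<notin> \<int>\<^sub>\<le>\<^sub>0"
      using that by (auto simp: S_def)
  qed
  have P: "(P n has_field_derivative P (Suc n) z) (at z)" if "z \<in> S" for n z
    unfolding P_def using nonpos[OF that]
    by (auto intro!: derivative_eq_intros simp: algebra_simps)
  have ds: "(s has_field_derivative p * c z) (at z)" for z
    unfolding s_def c_def by (auto intro!: derivative_eq_intros)
  have dc: "(c has_field_derivative - p * s z) (at z)" for z
    unfolding s_def c_def by (auto intro!: derivative_eq_intros)
  note der = P ds dc
  have uniq: "A' = B'" if "\<And>z. z \<in> S \<Longrightarrow> A z = B z" "z \<in> S"
      "(A has_field_derivative A') (at z)" "(B has_field_derivative B') (at z)" for A B A' B' z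
    using has_field_derivative_transform_within_open[OF that(3) S that(2) that(1)] that(4)
    by (auto intro: DERIV_unique)
  \<comment> \<open>The reflection formula for psi: differentiate rGamma z * rGamma (1 - z) = sin
    (pi z) / pi and divide by the product.\<close>
  have E0: "P 0 z * s z = p * c z" if z: "z \<in> S" for z
  proof -
    have "(\<lambda>z. rGamma z * rGamma (1 - z)) = (\<lambda>z. sin (p * z) / p)"
      by (intro ext) (simp add: rGamma_reflection_complex p_def)
    moreover have "((\<lambda>z. rGamma z * rGamma (1 - z)) has_field_derivative
        rGamma z * rGamma (1 - z) * P 0 z) (at z)"
      using nonpos[OF z] unfolding P_def
      by (auto intro!: derivative_eq_intros has_field_derivative_rGamma_no_nonpos_int
           DERIV_chain2[of rGamma] simp: algebra_simps)
    moreover have "((\<lambda>z. sin (p * z) / p) has_field_derivative c z) (at z)"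
      by (auto intro!: derivative_eq_intros simp: c_def p_def)
    ultimately have "rGamma z * rGamma (1 - z) * P 0 z = c z" by (metis DERIV_unique)
    then show ?thesis by (simp add: rGamma_reflection_complex p_def s_def field_simps)
  qed
  have E1: "P 1 z * s z + P 0 z * (p * c z) = - p * p * s z" if z: "z \<in> S" for z
    by (rule uniq[OF E0 z]) (use z in \<open>auto intro!: derivative_eq_intros der\<close>)
  have E2: "P 2 z * s z + 2 * p * P 1 z * c z - p * p * P 0 z * s z = - p * p * p * c z" if z: "z \<in> S" for z
    by (rule uniq[OF E1 z])
      (use z in \<open>auto intro!: derivative_eq_intros der simp: algebra_simps numeral_2_eq_2\<close>)
  have E3: "P 3 z * s z + 3 * p * P 2 z * c z - 3 * p * p * P 1 z * s z - p * p * p * P 0 z * c z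
      = p * p * p * p * s z" if z: "z \<in> S" for z
    by (rule uniq[OF E2 z])
      (use z in \<open>auto intro!: derivative_eq_intros der simp: algebra_simps numeral_2_eq_2 numeral_3_eq_3\<close>)
  have h: "1 / 2 \<in> S" by (auto simp: S_def)
  have "p * (1 / 2) = complex_of_real (pi / 2)" by (simp add: p_def)
  then have "s (1 / 2) = 1" "c (1 / 2) = 0"
    by (simp_all only: s_def c_def sin_of_real cos_of_real) simp_all
  \<comment> \<open>Where the cosine vanishes, \<open>E1\<close> gives P 1 = -p^2, and then
    \<open>E3\<close> gives P 3 = -2 p^4.\<close>
  with E1[OF h] E3[OF h] have "P 3 (1 / 2) - 3 * p * p * (- p * p) = p * p * p * p" by simp
  moreover have "P 3 (1 / 2) = - 2 * Polygamma 3 (1 / 2)" by (simp add: P_def)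
  ultimately have "Polygamma 3 (1 / 2) = p * p * p * p" by (simp add: algebra_simps)
  then show ?thesis by (simp add: p_def power4_eq_xxxx)
qed

text \<open>psi'''(1/2) is 96 times the sum of 1 / (2k + 1)^4, and the even terms of zeta(4) sum to
  zeta(4) / 16. The value is needed because zeta(4) enters the constant term of the residue at
  0.\<close>

lemma zeta_nat_4: "zeta_nat 4 = pi ^ 4 / 90"
proof -
  have "complex_of_real (Polygamma 3 (1 / 2)) = Polygamma 3 (of_real (1 / 2))"
    by (rule Polygamma_of_real [symmetric]) simp
  also have "\<dots> = of_real (pi ^ 4)" using Polygamma_3_one_half by simp
  finally have P: "Polygamma 3 (1 / 2 :: real) = pi ^ 4" by (simp only: of_real_eq_iff)
  have "(\<lambda>k. inverse ((1 / 2 + real k) ^ Suc 3)) sums (pi ^ 4 / 6)"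
    using Polygamma_LIMSEQ[of "1/2 :: real" 3] by (simp add: P fact_numeral)
  then have "(\<lambda>k. (1 / 16) * inverse ((1 / 2 + real k) ^ Suc 3)) sums ((1 / 16) * (pi ^ 4 / 6))"
    by (rule sums_mult)
  moreover have "(1 / 16) * inverse ((1 / 2 + real k) ^ Suc 3) = 1 / real (2 * k + 1) ^ 4" for k
  proof -
    have "1 / 2 + real k = real (2 * k + 1) / 2" by simp
    then show ?thesis by (simp only: power_divide) simp
  qed
  ultimately have odd: "(\<lambda>k. 1 / real (2 * k + 1) ^ 4) sums (pi ^ 4 / 96)" by simp
  have z: "(\<lambda>n. 1 / real (Suc n) ^ 4) sums zeta_nat 4" by (rule zeta_nat_sums) simp
  have "(\<lambda>n. 1 / real (2 * n + 1) ^ 4 + 1 / real (2 * n + 2) ^ 4) sums zeta_nat 4"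
    using sums_group[OF z, of 2] by (simp add: numeral_2_eq_2 mult.commute)
  moreover have "(\<lambda>n. 1 / real (2 * n + 1) ^ 4 + (1 / 16) * (1 / real (Suc n) ^ 4)) sums (pi ^ 4 / 96 + (1 / 16) * zeta_nat 4)"
    by (intro sums_add odd sums_mult z)
  moreover have "(1 / 16) * (1 / real (Suc n) ^ 4) = 1 / real (2 * n + 2) ^ 4" for n
  proof -
    have "real (2 * n + 2) = 2 * real (Suc n)" by simp
    then show ?thesis by (simp only: power_mult_distrib) simp
  qed
  ultimately have "zeta_nat 4 = pi ^ 4 / 96 + (1 / 16) * zeta_nat 4"
    by (simp only: sums_unique2)
  then show ?thesis by simp
qed

section \<open>The function \<open>\<psi>(z) - \<psi>(1)\<close> and its roots\<close>

definition Psi :: "complex \<Rightarrow> complex" where "Psi z = Digamma z - Digamma 1"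

text \<open>At negative integers this still holds, through inverse 0 = 0, so \<open>Psi\<close>
  takes a meaningless finite value at those poles; \<open>inv_Psi\<close> below repairs
  this.\<close>

lemma Psi_sums:
  assumes "z \<noteq> 0"
  shows "(\<lambda>k. inverse (of_nat (Suc k)) - inverse (z + of_nat k)) sums Psi z"
  using summable_sums[OF summable_Digamma[OF assms]] by (simp add: Psi_def Digamma_def[of z])

section \<open>Lower bounds for the modulus of \<open>Psi\<close>\<close>

lemma Im_Psi_sums:
  assumes "z \<noteq> 0"
  shows "(\<lambda>k. Im z / ((Re z + real k)\<^sup>2 + (Im z)\<^sup>2)) sums Im (Psi z)"
proof -
  have "Im (inverse (of_nat (Suc k)) - inverse (z + of_nat k)) = Im z / ((Re z + real k)\<^sup>2 + (Im z)\<^sup>2)" for k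
  proof -
    have "Im (inverse (complex_of_real (real (Suc k)))) = 0"
      unfolding of_real_inverse[symmetric] by (rule Im_complex_of_real)
    then show ?thesis by simp
  qed
  then show ?thesis using sums_Im[OF Psi_sums[OF assms]] by simp
qed

text \<open>All terms of the series for Im (Psi z) have the sign of Im z, so nothing cancels and any
  finite selection A of them is a lower bound. The estimates below differ only in the choice of
  A.\<close>

lemma Im_Psi_ge:
  assumes "Im z \<noteq> 0" "finite A"
  shows "(\<Sum>k\<in>A. \<bar>Im z\<bar> / ((Re z + real k)\<^sup>2 + (Im z)\<^sup>2)) \<le> cmod (Psi z)"
proof -
  let ?f = "\<lambda>k. Im z / ((Re z + real k)\<^sup>2 + (Im z)\<^sup>2)"
  have z: "z \<noteq> 0" using assms by auto
  have "(\<lambda>k. sgn (Im z) * ?f k) sums (sgn (Im z) * Im (Psi z))"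
    by (intro sums_mult Im_Psi_sums z)
  moreover have "(\<lambda>k. sgn (Im z) * ?f k) = (\<lambda>k. \<bar>Im z\<bar> / ((Re z + real k)\<^sup>2 + (Im z)\<^sup>2))"
    by (simp add: sgn_if abs_if)
  ultimately have s: "(\<lambda>k. \<bar>Im z\<bar> / ((Re z + real k)\<^sup>2 + (Im z)\<^sup>2)) sums (sgn (Im z) * Im (Psi z))"
    by simp
  have "(\<Sum>k\<in>A. \<bar>Im z\<bar> / ((Re z + real k)\<^sup>2 + (Im z)\<^sup>2)) \<le> sgn (Im z) * Im (Psi z)"
    unfolding sums_unique[OF s] by (intro sum_le_suminf sums_summable[OF s] assms) auto
  also have "\<dots> \<le> \<bar>Im (Psi z)\<bar>" by (auto simp: sgn_if)
  also have "\<dots> \<le> cmod (Psi z)" by (rule abs_Im_le_cmod)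
  finally show ?thesis .
qed

lemma Psi_nonzero: "Im z \<noteq> 0 \<Longrightarrow> Psi z \<noteq> 0"
  using Im_Psi_ge[of z "{0}"] by (force simp: divide_le_0_iff power2_eq_square sum_squares_le_zero_iff)

text \<open>A consists of more than |Im z| consecutive indices, from K on, for which Re z + k lies
  between 0 and C |Im z|. Each term is at least 1 / ((C^2 + 1) |Im z|), so the bound does not
  deteriorate as |Im z| grows.\<close>

lemma Psi_ge_strip:
  assumes "\<bar>Im z\<bar> \<ge> 1" "- real K \<le> Re z" "Re z + real K + \<bar>Im z\<bar> \<le> C * \<bar>Im z\<bar>" "C > 0"
  shows "1 / (C\<^sup>2 + 1) \<le> cmod (Psi z)"
proof -
  define y where "y = \<bar>Im z\<bar>"
  define n where "n = nat \<lfloor>y\<rfloor>"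
  have n: "real n \<le> y" "y < real n + 1" using assms(1) by (auto simp: n_def y_def)
  have y: "y \<ge> 1" "Im z \<noteq> 0" using assms by (auto simp: y_def)
  have "1 / (C\<^sup>2 + 1) = y * (1 / ((C\<^sup>2 + 1) * y))" using y by simp
  also have "\<dots> \<le> (\<Sum>k\<in>{K..K+n}. 1 / ((C\<^sup>2 + 1) * y))"
    using n y unfolding sum_constant by (intro mult_right_mono) auto
  also have "\<dots> \<le> (\<Sum>k\<in>{K..K+n}. \<bar>Im z\<bar> / ((Re z + real k)\<^sup>2 + (Im z)\<^sup>2))"
  proof (rule sum_mono)
    fix k assume k: "k \<in> {K..K+n}"
    have "0 \<le> Re z + real k" "Re z + real k \<le> C * y"
      using k assms n by (auto simp: y_def)
    then have "(Re z + real k)\<^sup>2 \<le> (C * y)\<^sup>2" by (intro power_mono) auto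
    then have "(Re z + real k)\<^sup>2 + (Im z)\<^sup>2 \<le> (C\<^sup>2 + 1) * y * y"
      by (simp add: y_def algebra_simps power2_eq_square)
    moreover have "(Re z + real k)\<^sup>2 + (Im z)\<^sup>2 > 0" using y by (simp add: add_nonneg_pos)
    ultimately have "y / ((C\<^sup>2 + 1) * y * y) \<le> y / ((Re z + real k)\<^sup>2 + (Im z)\<^sup>2)"
      using y by (intro divide_left_mono) (auto intro!: mult_pos_pos add_nonneg_pos)
    then show "1 / ((C\<^sup>2 + 1) * y) \<le> \<bar>Im z\<bar> / ((Re z + real k)\<^sup>2 + (Im z)\<^sup>2)"
      using y by (simp add: y_def)
  qed
  also have "\<dots> \<le> cmod (Psi z)" by (intro Im_Psi_ge y) auto
  finally show ?thesis .
qed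

text \<open>For |Im z| < 1 the single term k = K, which belongs to the pole on this line, is already
  1 / |Im z|.\<close>

lemma Psi_ge_left:
  assumes "Re z = - real K" "Im z \<noteq> 0"
  shows "1 / 2 \<le> cmod (Psi z)"
proof (cases "\<bar>Im z\<bar> \<ge> 1")
  case True
  then show ?thesis using Psi_ge_strip[of z K 1] assms by simp
next
  case False
  have "1 / 2 \<le> 1 / \<bar>Im z\<bar>" using False assms by (simp add: field_simps)
  also have "\<dots> = (\<Sum>k\<in>{K}. \<bar>Im z\<bar> / ((Re z + real k)\<^sup>2 + (Im z)\<^sup>2))"
    using assms by (simp add: power2_eq_square abs_if field_simps)
  also have "\<dots> \<le> cmod (Psi z)" by (intro Im_Psi_ge assms) auto
  finally show ?thesis .
qed

text \<open>Near the real axis the imaginary part gives nothing, so here the real part is used: all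
  its terms are nonnegative, and the term k = 0 is at least 1 - 1 / Re z.\<close>

lemma Psi_ge_right:
  assumes "Re z \<ge> 2"
  shows "1 / 2 \<le> cmod (Psi z)"
proof -
  have z: "z \<noteq> 0" using assms by auto
  let ?g = "\<lambda>k. inverse (of_nat (Suc k)) - inverse (z + of_nat k)"
  have s: "(\<lambda>k. Re (?g k)) sums Re (Psi z)"
    by (intro sums_Re Psi_sums z)
  have ge: "Re (?g k) \<ge> 1 / real (Suc k) - 1 / (Re z + real k)" for k
  proof -
    have "Re (inverse (z + of_nat k)) = (Re z + real k) / ((Re z + real k)\<^sup>2 + (Im z)\<^sup>2)"
      by simp
    also have "\<dots> \<le> (Re z + real k) / ((Re z + real k)\<^sup>2)"
      using assms by (intro divide_left_mono) (auto intro!: mult_pos_pos add_pos_nonneg)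
    also have "\<dots> = 1 / (Re z + real k)" using assms by (simp add: power2_eq_square)
    finally have "Re (inverse (z + of_nat k)) \<le> 1 / (Re z + real k)" .
    moreover have "Re (inverse (complex_of_real (real (Suc k)))) = 1 / real (Suc k)"
      unfolding of_real_inverse[symmetric] Re_complex_of_real by (simp add: inverse_eq_divide)
    ultimately show ?thesis by simp
  qed
  have nn: "0 \<le> Re (?g k)" for k
  proof (rule order.trans[OF _ ge])
    have "1 / (Re z + real k) \<le> 1 / real (Suc k)" using assms by (intro divide_left_mono) auto
    then show "0 \<le> 1 / real (Suc k) - 1 / (Re z + real k)" by simp
  qed
  have "1 / 2 \<le> 1 / real (Suc 0) - 1 / (Re z + real 0)" using assms by (simp add: field_simps)
  also have "\<dots> \<le> Re (?g 0)" by (rule ge)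
  also have "Re (?g 0) = (\<Sum>k\<in>{0}. Re (?g k))" by simp
  also have "\<dots> \<le> Re (Psi z)"
    unfolding sums_unique[OF s] by (intro sum_le_suminf sums_summable[OF s]) (use nn in auto)
  also have "\<dots> \<le> cmod (Psi z)" by (rule complex_Re_le_cmod)
  finally show ?thesis .
qed

text \<open>\<open>rGamma\<close> times \<open>Psi\<close>, continued to the poles of the digamma function. Working with this
  entire function makes \<open>1 / Psi\<close> holomorphic at the nonpositive integers without further ado.\<close>

definition rGamma_Psi :: "complex \<Rightarrow> complex" where
  "rGamma_Psi z = euler_mascheroni * rGamma z - deriv rGamma z"

definition inv_Psi :: "complex \<Rightarrow> complex" where
  "inv_Psi z = rGamma z / rGamma_Psi z"

lemma holomorphic_rGamma_Psi: "rGamma_Psi holomorphic_on A"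
  unfolding rGamma_Psi_def
  by (intro holomorphic_intros holomorphic_on_subset[OF holomorphic_deriv[of _ UNIV]]) auto

lemma isCont_rGamma_Psi [continuous_intros]:
  assumes "isCont f z"
  shows "isCont (\<lambda>x. rGamma_Psi (f x)) z"
proof (rule isCont_o2[OF assms])
  have "continuous_on UNIV rGamma_Psi"
    by (intro holomorphic_on_imp_continuous_on holomorphic_rGamma_Psi)
  then show "isCont rGamma_Psi (f z)" by (simp add: continuous_on_eq_continuous_at)
qed

lemma rGamma_Psi_eq: "z \<notin> \<int>\<^sub>\<le>\<^sub>0 \<Longrightarrow> rGamma_Psi z = rGamma z * Psi z"
  using DERIV_imp_deriv[OF has_field_derivative_rGamma_no_nonpos_int[of z UNIV]]
  by (simp add: rGamma_Psi_def Psi_def algebra_simps)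

text \<open>Used twice: the values are nonzero, so \<open>inv_Psi\<close> is regular and zero at the
  poles of psi; and their signs alternate, so there is a real root between any two neighbouring
  poles.\<close>

lemma rGamma_Psi_nonpos_int: "rGamma_Psi (- of_nat n) = - ((-1) ^ n * fact n)"
  using DERIV_imp_deriv[OF has_field_derivative_rGamma_nonpos_int[of n UNIV]]
  by (simp add: rGamma_Psi_def rGamma_eq_zero_iff)

lemma inv_Psi_eq: "z \<notin> \<int>\<^sub>\<le>\<^sub>0 \<Longrightarrow> inv_Psi z = 1 / Psi z"
  by (simp add: inv_Psi_def rGamma_Psi_eq rGamma_eq_zero_iff)

lemma inv_Psi_nonpos_int: "z \<in> \<int>\<^sub>\<le>\<^sub>0 \<Longrightarrow> inv_Psi z = 0"
  by (simp add: inv_Psi_def rGamma_eq_zero_iff)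

lemma norm_inv_Psi_le:
  assumes "c > 0" "z \<notin> \<int>\<^sub>\<le>\<^sub>0 \<Longrightarrow> c \<le> cmod (Psi z)"
  shows "cmod (inv_Psi z) \<le> 1 / c"
proof (cases "z \<in> \<int>\<^sub>\<le>\<^sub>0")
  case True
  then show ?thesis using assms by (simp add: inv_Psi_nonpos_int)
next
  case False
  then have "c \<le> cmod (Psi z)" by (rule assms)
  then have "1 / cmod (Psi z) \<le> 1 / c"
    using assms(1) by (intro divide_left_mono mult_pos_pos) linarith+
  then show ?thesis using False by (simp add: inv_Psi_eq norm_divide)
qed

lemma Psi_of_real: "x \<noteq> 0 \<Longrightarrow> Psi (of_real x) = of_real (Digamma x - Digamma 1)"
  by (simp add: Psi_def Polygamma_of_real)

section \<open>The real roots of psi(x) = psi(1)\<close>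

lemma nonpos_Int_real_cases:
  fixes x :: real
  assumes "x \<in> \<int>\<^sub>\<le>\<^sub>0"
  obtains n where "x = - real n"
  using assms by (auto elim!: nonpos_Ints_cases')

lemma not_nonpos_Int_between:
  fixes x :: real
  assumes "- real (Suc i) < x" "x < - real i"
  shows "x \<notin> \<int>\<^sub>\<le>\<^sub>0"
  using assms by (auto elim!: nonpos_Int_real_cases)

lemma Digamma_strict_mono_between:
  fixes x y :: real
  assumes "- real (Suc i) < x" "x < y" "y < - real i"
  shows "Digamma x < Digamma y"
proof (rule DERIV_pos_imp_increasing[OF assms(2)])
  fix t assume "x \<le> t" "t \<le> y"
  then have "t \<notin> \<int>\<^sub>\<le>\<^sub>0" using assms by (intro not_nonpos_Int_between[of i]) auto
  then show "\<exists>d. (Digamma has_real_derivative d) (at t) \<and> 0 < d"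
    using has_field_derivative_Polygamma[of t 0 UNIV] Polygamma_real_odd_pos[of t 1] by auto
qed

lemma rGamma_Psi_of_real_zero:
  assumes "Re (rGamma_Psi (of_real x)) = 0"
  shows "x \<notin> \<int>\<^sub>\<le>\<^sub>0" "Digamma x = Digamma 1"
proof -
  show x: "x \<notin> \<int>\<^sub>\<le>\<^sub>0"
  proof
    assume "x \<in> \<int>\<^sub>\<le>\<^sub>0"
    then obtain n where n: "x = - real n" by (rule nonpos_Int_real_cases)
    have "rGamma_Psi (of_real x) = of_real (- ((-1) ^ n * fact n))"
      using rGamma_Psi_nonpos_int[of n] by (simp add: n)
    then have "Re (rGamma_Psi (of_real x)) = - ((-1) ^ n * fact n)" by (simp only: Re_complex_of_real)
    with assms show False by simp
  qed
  then have "complex_of_real x \<notin> \<int>\<^sub>\<le>\<^sub>0" by (simp add: of_real_in_nonpos_Ints_iff)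
  moreover have "x \<noteq> 0" using x by auto
  ultimately have "rGamma_Psi (of_real x) = of_real (rGamma x * (Digamma x - Digamma 1))"
    by (simp add: rGamma_Psi_eq rGamma_complex_of_real Psi_of_real)
  then have "rGamma x * (Digamma x - Digamma 1) = 0" using assms by (simp only: Re_complex_of_real)
  then show "Digamma x = Digamma 1" using x by (simp add: rGamma_eq_zero_iff)
qed

text \<open>Justifies the definite description: existence by the intermediate value theorem,
  uniqueness by monotonicity of psi between poles. The index is always \<open>Suc i\<close>, since
  \<open>neg_root 0\<close> would describe a root in (0, 1), where there is none.\<close>

lemma neg_root:
  "- real (Suc i) < neg_root (Suc i)" "neg_root (Suc i) < - real i"
  "Digamma (neg_root (Suc i)) = Digamma 1"
proof -
  \<comment> \<open>Unlike psi itself, this function is continuous on the closed interval between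
    two poles and has usable values at its ends.\<close>
  define f where "f x = Re (rGamma_Psi (of_real x))" for x
  have cont: "continuous_on A f" for A
    unfolding f_def
    by (intro continuous_intros continuous_on_compose2[OF holomorphic_on_imp_continuous_on[OF holomorphic_rGamma_Psi[of UNIV]]]) auto
  have ends: "f (- real n) = - ((-1) ^ n * fact n)" for n
  proof -
    have "rGamma_Psi (of_real (- real n)) = of_real (- ((-1) ^ n * fact n))"
      using rGamma_Psi_nonpos_int[of n] by simp
    then show ?thesis unfolding f_def by (simp only: Re_complex_of_real)
  qed
  have "\<exists>x\<ge>- real (Suc i). x \<le> - real i \<and> f x = 0"
  proof (cases "even i")
    case True
    then have "f (- real i) \<le> 0" "0 \<le> f (- real (Suc i))" unfolding ends by simp_all
    then show ?thesis by (intro IVT2' cont) auto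
  next
    case False
    then have "0 \<le> f (- real i)" "f (- real (Suc i)) \<le> 0" unfolding ends by simp_all
    then show ?thesis by (intro IVT' cont) auto
  qed
  then obtain x where x: "- real (Suc i) \<le> x" "x \<le> - real i" "f x = 0" by blast
  have "f (- real n) \<noteq> 0" for n unfolding ends by simp
  with x have x': "- real (Suc i) < x" "x < - real i"
    by (metis order_less_le)+
  have D: "Digamma x = Digamma 1" using x(3) unfolding f_def by (rule rGamma_Psi_of_real_zero)
  have "neg_root (Suc i) = x"
    unfolding neg_root_def
  proof (rule the_equality)
    show "- real (Suc i) < x \<and> x < - (real (Suc i) - 1) \<and> Digamma x = Digamma (1::real)"
      using x' D by auto
    fix s :: real assume s: "- real (Suc i) < s \<and> s < - (real (Suc i) - 1) \<and> Digamma s = Digamma (1::real)"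
    then show "s = x"
      using Digamma_strict_mono_between[of i s x] Digamma_strict_mono_between[of i x s] x' D
      by (cases s x rule: linorder_cases) auto
  qed
  with x' D show "- real (Suc i) < neg_root (Suc i)" "neg_root (Suc i) < - real i"
    "Digamma (neg_root (Suc i)) = Digamma 1" by auto
qed

lemma neg_root_less: "i < j \<Longrightarrow> neg_root (Suc j) < neg_root (Suc i)"
  using neg_root(1)[of i] neg_root(2)[of j] by linarith

lemma neg_root_not_nonpos_Int: "neg_root (Suc i) \<notin> \<int>\<^sub>\<le>\<^sub>0"
  using neg_root by (intro not_nonpos_Int_between)

lemma neg_root_unique:
  assumes "- real (Suc i) < x" "x < - real i" "Digamma x = Digamma 1"
  shows "x = neg_root (Suc i)"
  using Digamma_strict_mono_between[of i x "neg_root (Suc i)"]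
    Digamma_strict_mono_between[of i "neg_root (Suc i)" x] assms neg_root[of i]
  by (cases x "neg_root (Suc i)" rule: linorder_cases) auto

text \<open>The complete list of possible poles of \<open>inv_Psi\<close>: off the real axis Im Psi
  is nonzero, and on it psi is increasing between poles and to the right of 0.\<close>

lemma rGamma_Psi_zero:
  assumes "rGamma_Psi z = 0"
  shows "z = 1 \<or> (\<exists>i. z = of_real (neg_root (Suc i)))"
proof -
  have "Im z = 0"
  proof (rule ccontr)
    assume "Im z \<noteq> 0"
    moreover from this have "z \<notin> \<int>\<^sub>\<le>\<^sub>0" by (auto elim!: nonpos_Ints_cases')
    ultimately show False using assms Psi_nonzero[of z] by (simp add: rGamma_Psi_eq rGamma_eq_zero_iff)
  qed
  then obtain x where z: "z = of_real x" using complex_is_Real_iff Reals_cases by metis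
  then have x: "x \<notin> \<int>\<^sub>\<le>\<^sub>0" "Digamma x = Digamma 1" using assms rGamma_Psi_of_real_zero[of x] by auto
  show ?thesis
  proof (cases "x > 0")
    case True
    then have "x = 1" using x Digamma_real_strict_mono[of x 1] Digamma_real_strict_mono[of 1 x]
      by (cases x "1::real" rule: linorder_cases) auto
    then show ?thesis using z by simp
  next
    case False
    define i where "i = nat \<lfloor>- x\<rfloor>"
    have i: "real i \<le> - x" "- x < real i + 1" using False by (auto simp: i_def)
    have "x \<noteq> - real i" using x by auto
    with i have "- real (Suc i) < x" "x < - real i" by auto
    then have "x = neg_root (Suc i)" using x by (intro neg_root_unique)
    then show ?thesis using z by blast
  qed
qed

text \<open>The zero of \<open>Psi\<close> is simple because psi' is positive on the real
  axis.\<close>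

lemma inv_Psi_simple_pole:
  assumes "Digamma x = Digamma (1 :: real)" "x \<notin> \<int>\<^sub>\<le>\<^sub>0"
  shows "((\<lambda>w. inv_Psi w * (w - of_real x)) \<longlongrightarrow> 1 / of_real (Polygamma 1 x)) (at (of_real x))"
proof -
  let ?z = "complex_of_real x"
  have z: "?z \<notin> \<int>\<^sub>\<le>\<^sub>0" using assms by (simp add: of_real_in_nonpos_Ints_iff)
  have x0: "x \<noteq> 0" using assms by auto
  have "(Psi has_field_derivative Polygamma 1 ?z) (at ?z)"
    unfolding Psi_def using z by (auto intro!: derivative_eq_intros)
  moreover have "Psi ?z = 0" using x0 assms by (simp add: Psi_of_real)
  ultimately have "((\<lambda>w. Psi w / (w - ?z)) \<longlongrightarrow> of_real (Polygamma 1 x)) (at ?z)"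
    using x0 by (simp add: has_field_derivative_iff Polygamma_of_real)
  moreover have "Polygamma 1 x \<noteq> 0" using Polygamma_real_odd_pos[of x 1] assms by auto
  ultimately have "((\<lambda>w. 1 / (Psi w / (w - ?z))) \<longlongrightarrow> 1 / of_real (Polygamma 1 x)) (at ?z)"
    by (intro tendsto_intros) auto
  moreover have "\<forall>\<^sub>F w in at ?z. w \<in> - \<int>\<^sub>\<le>\<^sub>0"
    using z by (intro eventually_at_in_open') auto
  then have "\<forall>\<^sub>F w in at ?z. 1 / (Psi w / (w - ?z)) = inv_Psi w * (w - ?z)"
    by eventually_elim (auto simp: inv_Psi_eq)
  ultimately show ?thesis by (rule Lim_transform_eventually)
qed

lemma inv_Psi_of_nat: "inv_Psi (of_nat (Suc j)) = 1 / of_real (harm j)"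
proof -
  have "of_nat (Suc j) \<notin> (\<int>\<^sub>\<le>\<^sub>0 :: complex set)"
    by (metis of_nat_in_nonpos_Ints_iff nat.distinct(1))
  then show ?thesis unfolding inv_Psi_eq[OF \<open>_ \<notin> _\<close>] Psi_def Digamma_of_nat by (simp add: of_real_harm)
qed

section \<open>Residues of the Rice integrand\<close>

text \<open>This is the Beta function B(m + 1, -s), with residue -(-1)^j (m choose j) at j. As a
  finite product it shows its poles and is easy to bound factor by factor.\<close>

definition rice_kernel :: "nat \<Rightarrow> complex \<Rightarrow> complex" where
  "rice_kernel m s = fact m / (\<Prod>k\<le>m. (of_nat k - s))"

definition rice :: "nat \<Rightarrow> complex \<Rightarrow> complex" where
  "rice m s = rice_kernel m s * inv_Psi (s + 1) / s"

definition rice_poles :: "nat \<Rightarrow> nat \<Rightarrow> complex set" where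
  "rice_poles m K = of_nat ` {..m} \<union> (\<lambda>i. of_real (neg_root (Suc i)) - 1) ` {..<K}"

text \<open>The half-plane ends at the first pole not listed in \<open>rice_poles m K\<close>. That
  pole lies strictly to the left of -(K + 1), so the whole contour fits inside.\<close>

definition rice_domain :: "nat \<Rightarrow> complex set" where
  "rice_domain K = {s. Re s > neg_root (Suc K) - 1}"

lemma finite_rice_poles: "finite (rice_poles m K)"
  by (simp add: rice_poles_def)

lemma open_rice_domain: "open (rice_domain K)"
  unfolding rice_domain_def by (rule open_halfspace_Re_gt)

lemma rice_holomorphic: "rice m holomorphic_on rice_domain K - rice_poles m K"
proof -
  have "rGamma_Psi (s + 1) \<noteq> 0" if s: "s \<in> rice_domain K" "s \<notin> rice_poles m K" for s
  proof
    assume "rGamma_Psi (s + 1) = 0"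
    then consider "s + 1 = 1" | i where "s + 1 = of_real (neg_root (Suc i))"
      using rGamma_Psi_zero by blast
    then show False
    proof cases
      case 1
      then have "s = of_nat 0" by simp
      with s show False by (auto simp: rice_poles_def)
    next
      case 2
      then have s': "s = of_real (neg_root (Suc i)) - 1" by (simp add: algebra_simps)
      with s have "i \<ge> K" unfolding rice_poles_def by (metis UnI2 image_eqI lessThan_iff not_less)
      then have "neg_root (Suc i) \<le> neg_root (Suc K)"
        using neg_root_less[of K i] by (cases "i = K") auto
      with s' s show False by (simp add: rice_domain_def)
    qed
  qed
  moreover have "(\<Prod>k\<le>m. (of_nat k - s)) \<noteq> 0" "s \<noteq> 0" if s: "s \<notin> rice_poles m K" for s
    using s by (auto simp: rice_poles_def)
  ultimately show ?thesis
    unfolding rice_def rice_kernel_def inv_Psi_def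
    by (intro holomorphic_intros holomorphic_on_compose_gen[OF _ holomorphic_rGamma_Psi[of UNIV], unfolded o_def]) auto
qed

text \<open>The parameter K is free here; it only has to be large enough for p to be listed.\<close>

lemma rice_residue_simple:
  assumes "p \<in> rice_poles m K" "((\<lambda>w. rice m w * (w - p)) \<longlongrightarrow> c) (at p)"
  shows "residue (rice m) p = c"
proof (rule residue_simple'[of "rice_domain K - (rice_poles m K - {p})"])
  show "open (rice_domain K - (rice_poles m K - {p}))"
    by (intro open_Diff open_rice_domain finite_imp_closed) (simp add: finite_rice_poles)
  have "Re q > neg_root (Suc K) - 1" if "q \<in> rice_poles m K" for q
  proof -
    have "neg_root (Suc K) < 0" using neg_root(2)[of K] by simp
    then show ?thesis using that neg_root_less by (auto simp: rice_poles_def)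
  qed
  then show "p \<in> rice_domain K - (rice_poles m K - {p})" using assms by (auto simp: rice_domain_def)
  show "rice m holomorphic_on rice_domain K - (rice_poles m K - {p}) - {p}"
    using assms by (intro holomorphic_on_subset[OF rice_holomorphic[of m K]]) auto
qed fact

lemma prod_diff_of_nat:
  assumes "j \<le> m"
  shows "(\<Prod>k\<in>{..m}-{j}. (of_nat k - of_nat j :: 'a :: field_char_0)) = (-1) ^ j * fact j * fact (m - j)"
proof -
  have split: "{..m} - {j} = {..<j} \<union> {j<..m}" using assms by auto
  have "(\<Prod>k\<in>{..m}-{j}. (of_nat k - of_nat j :: 'a)) =
      (\<Prod>k<j. (of_nat k - of_nat j)) * (\<Prod>k\<in>{j<..m}. (of_nat k - of_nat j))"
    unfolding split by (rule prod.union_disjoint) auto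
  also have "(\<Prod>k<j. (of_nat k - of_nat j :: 'a)) = (\<Prod>i=1..j. (-1) * of_nat i)"
    by (rule prod.reindex_bij_witness[of _ "\<lambda>i. j - i" "\<lambda>k. j - k"]) (auto simp: of_nat_diff)
  also have "\<dots> = (-1) ^ j * fact j" unfolding prod.distrib by (simp add: fact_prod)
  also have "(\<Prod>k\<in>{j<..m}. (of_nat k - of_nat j :: 'a)) = (\<Prod>i=1..m-j. of_nat i)"
    by (rule prod.reindex_bij_witness[of _ "\<lambda>i. i + j" "\<lambda>k. k - j"]) (auto simp: of_nat_diff)
  also have "\<dots> = fact (m - j)" by (simp add: fact_prod)
  finally show ?thesis by simp
qed

lemma rGamma_Psi_of_nat_nonzero:
  assumes "j > 0"
  shows "rGamma_Psi (of_nat j + 1) \<noteq> 0"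
proof
  assume "rGamma_Psi (of_nat j + 1) = 0"
  then consider "complex_of_nat j + 1 = 1" | i where "complex_of_nat j + 1 = of_real (neg_root (Suc i))"
    using rGamma_Psi_zero by blast
  then show False
  proof cases
    case 1
    with assms show ?thesis by simp
  next
    case 2
    then have "real j + 1 = neg_root (Suc i)"
      by (metis of_real_1 of_real_add of_real_eq_iff of_real_of_nat_eq)
    with neg_root(2)[of i] show ?thesis by linarith
  qed
qed

lemma rice_residue_of_nat:
  assumes "1 \<le> j" "j \<le> m"
  shows "residue (rice m) (of_nat j) = of_real ((-1) ^ (j + 1) * real (m choose j) / (real j * harm j))"
proof (rule rice_residue_simple[of _ m 0])
  show "of_nat j \<in> rice_poles m 0" using assms by (auto simp: rice_poles_def)
  \<comment> \<open>The factor k = j of the kernel is cancelled against w - j; the sign arises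
    because that factor is j - w.\<close>
  let ?g = "\<lambda>w. - (fact m / (\<Prod>k\<in>{..m}-{j}. (of_nat k - w)) * inv_Psi (w + 1) / w)"
  have p: "(\<Prod>k\<in>{..m}-{j}. (of_nat k - of_nat j)) \<noteq> (0 :: complex)"
    using assms by (subst prod_diff_of_nat) auto
  have "isCont ?g (of_nat j)"
    using p assms rGamma_Psi_of_nat_nonzero[of j] unfolding inv_Psi_def
    by (intro continuous_intros) auto
  then have "(?g \<longlongrightarrow> ?g (of_nat j)) (at (of_nat j))" by (simp add: isCont_def)
  moreover have "\<forall>\<^sub>F w in at (of_nat j). ?g w = rice m w * (w - of_nat j)"
  proof (rule eventually_mono[OF eventually_neq_at_within[of "of_nat j"]])
    fix w assume w: "w \<noteq> complex_of_nat j"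
    define d where "d = of_nat j - w"
    define P where "P = (\<Prod>k\<in>{..m}-{j}. (of_nat k - w))"
    have d: "d \<noteq> 0" "w - of_nat j = - d" using w by (auto simp: d_def)
    have "(\<Prod>k\<le>m. (of_nat k - w)) = d * P"
      unfolding d_def P_def using assms by (intro prod.remove) auto
    then have "rice m w * (w - of_nat j) = fact m / (d * P) * inv_Psi (w + 1) / w * (- d)"
      by (simp only: rice_def rice_kernel_def d)
    also have "\<dots> = - (fact m / P * inv_Psi (w + 1) / w)"
      using d(1) by simp
    finally show "?g w = rice m w * (w - of_nat j)" by (simp add: P_def)
  qed
  ultimately have "((\<lambda>w. rice m w * (w - of_nat j)) \<longlongrightarrow> ?g (of_nat j)) (at (of_nat j))"
    by (rule Lim_transform_eventually)
  also have "?g (of_nat j) = of_real ((-1) ^ (j + 1) * real (m choose j) / (real j * harm j))"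
  proof -
    have i: "inv_Psi (of_nat j + 1) = 1 / of_real (harm j)"
      using inv_Psi_of_nat[of j] by (simp add: add.commute)
    have b: "complex_of_nat (m choose j) = fact m / (fact j * fact (m - j))"
      using assms(2) by (rule binomial_fact)
    have "fact m / ((-1) ^ j * fact j * fact (m - j)) = (-1) ^ j * complex_of_nat (m choose j)"
      unfolding b by (cases "even j") simp_all
    then have "?g (of_nat j) = - ((-1) ^ j * complex_of_nat (m choose j) * (1 / of_real (harm j)) / of_nat j)"
      by (simp only: prod_diff_of_nat[OF assms(2)] i)
    also have "\<dots> = of_real ((-1) ^ (j + 1) * real (m choose j) / (real j * harm j))"
      by (simp add: mult.commute)
    finally show ?thesis .
  qed
  finally show "((\<lambda>w. rice m w * (w - of_nat j)) \<longlongrightarrow> of_real ((-1) ^ (j + 1) * real (m choose j) / (real j * harm j))) (at (of_nat j))" .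
qed

lemma rice_residue_neg_root:
  fixes i m :: nat
  defines "r \<equiv> neg_root (Suc i)"
  shows "residue (rice m) (of_real r - 1) =
    of_real (- fact m / (\<Prod>k\<le>m. real k + (1 - r)) / ((1 - r) * Polygamma 1 r))"
proof (rule rice_residue_simple[of _ m "Suc i"])
  show "of_real r - 1 \<in> rice_poles m (Suc i)" by (auto simp: rice_poles_def r_def)
  have r: "r < 0" using neg_root(2)[of i] unfolding r_def by linarith
  let ?p = "complex_of_real r - 1"
  have f: "filterlim (\<lambda>w. w + 1) (at (of_real r)) (at ?p)"
    unfolding filterlim_at
    by (auto intro!: tendsto_eq_intros eventually_mono[OF eventually_neq_at_within[of ?p]] simp: algebra_simps)
  have L: "((\<lambda>w. inv_Psi w * (w - of_real r)) \<longlongrightarrow> 1 / of_real (Polygamma 1 r)) (at (of_real r))"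
    unfolding r_def by (intro inv_Psi_simple_pole neg_root neg_root_not_nonpos_Int)
  have nz: "(\<Prod>k\<le>m. (of_nat k - ?p)) \<noteq> 0"
  proof -
    have "Re (of_nat k - ?p) \<noteq> 0" for k using r by simp
    then have "of_nat k - ?p \<noteq> 0" for k by (metis zero_complex.simps(1))
    then show ?thesis by simp
  qed
  have p0: "?p \<noteq> 0"
    using r by (auto simp: complex_eq_iff)
  have lim: "((\<lambda>w. fact m / (\<Prod>k\<le>m. (of_nat k - w)) * (inv_Psi (w + 1) * (w + 1 - of_real r)) / w) \<longlongrightarrow>
      fact m / (\<Prod>k\<le>m. (of_nat k - ?p)) * (1 / of_real (Polygamma 1 r)) / ?p) (at ?p)"
    using nz p0 by (intro tendsto_intros filterlim_compose[OF L f]) auto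
  have e1: "fact m / (\<Prod>k\<le>m. (of_nat k - w)) * (inv_Psi (w + 1) * (w + 1 - of_real r)) / w
      = rice m w * (w - ?p)" for w
  proof -
    have "w + 1 - of_real r = w - ?p" by simp
    then show ?thesis by (simp only: rice_def rice_kernel_def mult_ac times_divide_eq_right times_divide_eq_left)
  qed
  have e2: "fact m / (\<Prod>k\<le>m. (of_nat k - ?p)) * (1 / of_real (Polygamma 1 r)) / ?p =
      of_real (- fact m / (\<Prod>k\<le>m. real k + (1 - r)) / ((1 - r) * Polygamma 1 r))"
  proof -
    have P: "(\<Prod>k\<le>m. (of_nat k - ?p)) = of_real (\<Prod>k\<le>m. real k + (1 - r))"
      unfolding of_real_prod by (intro prod.cong) auto
    have "fact m / of_real P * (1 / of_real q) / ?p = of_real (- fact m / P / ((1 - r) * q))" for P q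
    proof -
      have "r - 1 = - (1 - r)" by simp
      then have "- fact m / P / ((1 - r) * q) = fact m / P * (1 / q) / (r - 1)"
        by (simp only: divide_minus_right) simp
      then show ?thesis by simp
    qed
    then show ?thesis unfolding P .
  qed
  show "((\<lambda>w. rice m w * (w - ?p)) \<longlongrightarrow>
      of_real (- fact m / (\<Prod>k\<le>m. real k + (1 - r)) / ((1 - r) * Polygamma 1 r))) (at ?p)"
    using lim unfolding e1 e2 .
qed

section \<open>The triple pole at 0, by formal power series\<close>

lemma inverse_one_minus_const_fps_X:
  "inverse (1 - fps_const c * fps_X) = Abs_fps (\<lambda>n. c ^ n :: 'a :: field)"
proof (rule fps_inverse_unique)
  show "(1 - fps_const c * fps_X) * Abs_fps (\<lambda>n. c ^ n) = 1"
  proof (rule fps_ext)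
    fix n
    show "fps_nth ((1 - fps_const c * fps_X) * Abs_fps (\<lambda>n. c ^ n)) n = fps_nth 1 n"
      by (cases n) (simp_all add: left_diff_distrib mult.assoc)
  qed
qed

lemma fps_mult_nth_2:
  "fps_nth (A * B) 2 = fps_nth A 0 * fps_nth B 2 + fps_nth A 1 * fps_nth B 1 + fps_nth A 2 * fps_nth B 0"
  by (simp add: fps_mult_nth numeral_2_eq_2 atLeast0_atMost_Suc add_ac)

text \<open>The product of the series 1 / (1 - s / k) generates the complete homogeneous symmetric
  polynomials in 1, 1/2, ..., 1/m; the second one is half the sum of the squared first power sum and
  the second power sum.\<close>

lemma kernel_fps_coeffs:
  fixes m :: nat
  defines "A \<equiv> (\<Prod>k=1..m. inverse (1 - fps_const (1 / of_nat k) * fps_X) :: complex fps)"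
  defines "h \<equiv> harm m" and "h2 \<equiv> (\<Sum>k=1..m. 1 / of_nat k ^ 2)"
  shows "fps_nth A 0 = 1" "fps_nth A 1 = h" "fps_nth A 2 = (h\<^sup>2 + h2) / 2"
proof -
  have "fps_nth A 0 = 1 \<and> fps_nth A 1 = h \<and> fps_nth A 2 = (h\<^sup>2 + h2) / 2"
    unfolding A_def h_def h2_def
  proof (induction m)
    case 0
    then show ?case by (simp add: harm_def)
  next
    case (Suc m)
    define A where "A = (\<Prod>k=1..m. inverse (1 - fps_const (1 / of_nat k) * fps_X) :: complex fps)"
    define c :: complex where "c = 1 / of_nat (Suc m)"
    have A: "(\<Prod>k=1..Suc m. inverse (1 - fps_const (1 / of_nat k) * fps_X) :: complex fps) = A * Abs_fps (\<lambda>n. c ^ n)"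
      by (simp only: A_def c_def prod.cl_ivl_Suc inverse_one_minus_const_fps_X) simp
    have h: "(harm (Suc m) :: complex) = harm m + c" by (simp add: harm_Suc c_def inverse_eq_divide)
    have h2: "(\<Sum>k=1..Suc m. 1 / of_nat k ^ 2) = (\<Sum>k=1..m. 1 / of_nat k ^ 2) + c ^ 2"
      by (simp add: c_def power_divide)
    show ?case
      using Suc unfolding A h h2 A_def[symmetric]
      by (simp add: fps_mult_nth_1 fps_mult_nth_2 power2_eq_square field_simps)
  qed
  then show "fps_nth A 0 = 1" "fps_nth A 1 = h" "fps_nth A 2 = (h\<^sup>2 + h2) / 2" by auto
qed

lemma Polygamma_1_zeta: "Polygamma (Suc n) 1 / fact (Suc n) = complex_of_real ((-1) ^ n * zeta_nat (n + 2))"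
proof -
  have "(\<lambda>k. inverse ((1 + complex_of_nat k) ^ Suc (Suc n))) sums ((-1) ^ Suc (Suc n) * Polygamma (Suc n) 1 / fact (Suc n))"
    by (rule Polygamma_LIMSEQ) auto
  moreover have "(\<lambda>k. complex_of_real (1 / real (Suc k) ^ (n + 2))) sums of_real (zeta_nat (n + 2))"
    by (intro sums_of_real zeta_nat_sums) auto
  moreover have "complex_of_real (1 / real (Suc k) ^ (n + 2)) = inverse ((1 + of_nat k) ^ Suc (Suc n))" for k
    by (simp add: inverse_eq_divide)
  ultimately have "(-1) ^ n * (Polygamma (Suc n) 1 / fact (Suc n)) = complex_of_real (zeta_nat (n + 2))"
    by (simp only: sums_unique2) (simp add: sums_unique2)
  then have "(-1) ^ n * ((-1) ^ n * (Polygamma (Suc n) 1 / fact (Suc n))) = complex_of_real ((-1) ^ n * zeta_nat (n + 2))"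
    by simp
  then show ?thesis by (simp add: power_mult_distrib[symmetric] flip: mult.assoc)
qed

text \<open>Near 0 the integrand is -a(s) b(s) / s^3, where a is the kernel without its factor 1 /
  (-s) and b(s) = s / Psi(1 + s) is regular. The residue is the second coefficient of -a b.\<close>

lemma rice_residue_0:
  "residue (rice m) 0 = - of_real (((harm m)\<^sup>2 + (\<Sum>k=1..m. 1 / real k ^ 2)) / 2 / zeta_nat 2
     + zeta_nat 3 / zeta_nat 2 ^ 2 * harm m + zeta_nat 3 ^ 2 / zeta_nat 2 ^ 3 - zeta_nat 4 / zeta_nat 2 ^ 2)"
proof -
  define A where "A = (\<Prod>k=1..m. inverse (1 - fps_const (1 / of_nat k) * fps_X) :: complex fps)"
  define z where "z k = complex_of_real (zeta_nat k)" for k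
  have z2: "z 2 \<noteq> 0" by (simp add: z_def zeta_nat_2)
  define G where "G = fps_expansion Digamma 1 - fps_const (Digamma (1 :: complex))"
  have "(Digamma :: complex \<Rightarrow> complex) analytic_on {1}"
    by (intro analytic_on_Polygamma) auto
  then have "(\<lambda>x. Digamma (1 + x)) has_fps_expansion fps_expansion Digamma (1 :: complex)"
    by (rule analytic_at_imp_has_fps_expansion)
  then have G: "(\<lambda>s. Psi (1 + s)) has_fps_expansion G"
    unfolding Psi_def G_def by (intro fps_expansion_intros)
  have one: "(1 :: complex) \<notin> \<int>\<^sub>\<le>\<^sub>0" by auto
  have nth: "fps_nth (fps_expansion Digamma (1 :: complex)) n = Polygamma n 1 / fact n" for n
    using higher_deriv_Polygamma[OF one, of n 0] by (simp add: fps_expansion_def)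
  have G0: "fps_nth G 0 = 0" unfolding G_def by (simp add: nth)
  have Gn: "fps_nth G (Suc n) = (-1) ^ n * z (n + 2)" for n
    unfolding G_def z_def using Polygamma_1_zeta[of n] by (simp add: nth)
  have G1: "fps_nth G 1 = z 2" using Gn[of 0] by (simp add: numeral_2_eq_2)
  have G2: "fps_nth G 2 = - z 3" using Gn[of 1] by (simp add: numeral_2_eq_2 numeral_3_eq_3)
  have G3: "fps_nth G 3 = z 4" using Gn[of 2] by (simp add: numeral_3_eq_3 eval_nat_numeral)
  have sub: "subdegree G = 1" by (rule subdegreeI) (use G0 G1 z2 in auto)
  then have Gnz: "G \<noteq> 0" by auto
  \<comment> \<open>\<open>G\<close> begins zeta(2) s - zeta(3) s^2 + zeta(4) s^3, so comparing the
    coefficients 1, 2, 3 in B * G = X determines B up to order 2.\<close>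
  define B where "B = (fps_X :: complex fps) / G"
  have BG: "B * G = fps_X"
    unfolding B_def using Gnz sub by (intro fps_times_divide_eq) auto
  \<comment> \<open>The value at 0 fills in the removable singularity.\<close>
  define b where "b s = (if s = 0 then 1 / z 2 else s / Psi (1 + s))" for s
  have b: "b has_fps_expansion B"
    unfolding b_def B_def
    by (rule has_fps_expansion_divide) (use G Gnz sub G1 in \<open>auto intro: has_fps_expansion_fps_X\<close>)
  have B0: "fps_nth B 0 = 1 / z 2"
  proof -
    have "fps_nth (B * G) 1 = 1" by (simp add: BG)
    then show ?thesis using z2 by (simp add: fps_mult_nth_1 G0 G1[simplified] field_simps)
  qed
  have B1: "fps_nth B 1 = z 3 / z 2 ^ 2"
  proof -
    have "fps_nth (B * G) 2 = 0" by (simp add: BG)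
    then show ?thesis using z2 G0 G1 G2 B0 unfolding fps_mult_nth_2 by (simp add: field_simps power2_eq_square)
  qed
  have B2: "fps_nth B 2 = z 3 ^ 2 / z 2 ^ 3 - z 4 / z 2 ^ 2"
  proof -
    have "fps_nth (B * G) 3 = 0" by (simp add: BG)
    moreover have "fps_nth (B * G) 3 = fps_nth B 0 * fps_nth G 3 + fps_nth B 1 * fps_nth G 2
        + fps_nth B 2 * fps_nth G 1 + fps_nth B 3 * fps_nth G 0"
      by (simp add: fps_mult_nth eval_nat_numeral atLeast0_atMost_Suc)
    ultimately have "fps_nth B 2 * z 2 = z 3 ^ 2 / z 2 ^ 2 - z 4 / z 2"
      unfolding G0 G1 G2 G3 B0 B1 by (simp add: power2_eq_square algebra_simps add_eq_0_iff)
    then have "fps_nth B 2 = (z 3 ^ 2 / z 2 ^ 2 - z 4 / z 2) / z 2" using z2 by (simp add: field_simps)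
    then show ?thesis by (simp add: diff_divide_distrib power2_eq_square power3_eq_cube)
  qed
  define a where "a s = (\<Prod>k=1..m. inverse (1 - (1 / of_nat k) * s))" for s :: complex
  have a: "a has_fps_expansion A"
    unfolding a_def A_def by (intro fps_expansion_intros) auto
  have "(\<lambda>s. - (a s * b s)) has_fps_expansion - (A * B)"
    by (intro fps_expansion_intros a b)
  then have "residue (\<lambda>s. - (a s * b s) / s ^ Suc 2) 0 = fps_nth (- (A * B)) 2"
    by (rule residue_fps_expansion_over_power_at_0)
  moreover have "residue (rice m) 0 = residue (\<lambda>s. - (a s * b s) / s ^ Suc 2) 0"
  proof (rule residue_cong)
    have "\<forall>\<^sub>F s in at 0. s \<in> - ((\<lambda>s. s + 1) -` \<int>\<^sub>\<le>\<^sub>0) - {0 :: complex}"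
      by (intro eventually_at_in_open' eventually_at_in_open closed_vimage continuous_intros open_Compl) auto
    then show "\<forall>\<^sub>F s in at 0. rice m s = - (a s * b s) / s ^ Suc 2"
    proof eventually_elim
      case (elim s)
      then have s: "s \<noteq> 0" "s + 1 \<notin> \<int>\<^sub>\<le>\<^sub>0" by auto
      have "(\<Prod>k\<le>m. (of_nat k - s)) = - s * (\<Prod>k=1..m. (of_nat k - s))"
      proof -
        have "{..m} = insert 0 {1..m}" by auto
        then show ?thesis by simp
      qed
      moreover have "fact m / (\<Prod>k=1..m. (of_nat k - s)) = a s"
      proof -
        have "fact m / (\<Prod>k=1..m. (of_nat k - s)) = (\<Prod>k=1..m. of_nat k / (of_nat k - s))"
          by (simp add: fact_prod prod_dividef)
        also have "\<dots> = a s"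
          unfolding a_def
        proof (intro prod.cong refl)
          fix k assume "k \<in> {1..m}"
          then have "1 - 1 / of_nat k * s = (of_nat k - s) / of_nat k" by (simp add: field_simps)
          then show "of_nat k / (of_nat k - s) = inverse (1 - 1 / of_nat k * s)" by simp
        qed
        finally show ?thesis .
      qed
      ultimately have "rice_kernel m s = - a s / s"
        by (simp add: rice_kernel_def divide_inverse)
      moreover have "inv_Psi (s + 1) = b s / s" using s by (simp add: inv_Psi_eq b_def add.commute)
      ultimately show ?case by (simp add: rice_def power3_eq_cube)
    qed
  qed (rule refl)
  ultimately have "residue (rice m) 0 = - (fps_nth A 0 * fps_nth B 2 + fps_nth A 1 * fps_nth B 1 + fps_nth A 2 * fps_nth B 0)"
    by (simp add: fps_mult_nth_2)
  also have "\<dots> = - (z 3 ^ 2 / z 2 ^ 3 - z 4 / z 2 ^ 2 + harm m * (z 3 / z 2 ^ 2)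
        + ((harm m)\<^sup>2 + (\<Sum>k=1..m. 1 / of_nat k ^ 2)) / 2 * (1 / z 2))"
    unfolding A_def kernel_fps_coeffs B0 B1 B2 by (simp only: mult_1_left)
  finally show ?thesis by (simp add: z_def of_real_harm add_divide_distrib algebra_simps)
qed

section \<open>The contour integral\<close>

text \<open>One power of r is enough: with the factor 1 / s the integrand is of order R^(-2) on the
  far sides, whose length is of order R.\<close>

lemma rice_kernel_bound:
  assumes "\<And>k. k \<le> m \<Longrightarrow> r \<le> cmod (of_nat k - s)" "r \<ge> 1"
  shows "cmod (rice_kernel m s) \<le> fact m / r"
proof -
  have "r \<le> r ^ Suc m" using self_le_power[of r "Suc m"] assms(2) by simp
  also have "\<dots> = (\<Prod>k\<le>m. r)" by simp
  also have "\<dots> \<le> (\<Prod>k\<le>m. cmod (of_nat k - s))"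
    using assms by (intro prod_mono) auto
  finally have "r \<le> (\<Prod>k\<le>m. cmod (of_nat k - s))" .
  then show ?thesis
    using assms(2) unfolding rice_kernel_def norm_divide prod_norm[symmetric] norm_fact
    by (intro divide_left_mono mult_pos_pos) auto
qed

lemma rice_bound_far:
  assumes R: "R \<ge> real m + 1" "R \<ge> real K + 1"
    and s: "\<bar>Im s\<bar> = R \<and> - (real K + 1) \<le> Re s \<and> Re s \<le> R \<or> Re s = R"
  shows "cmod (rice m s) \<le> fact m * ((real K + 3)\<^sup>2 + 1) / ((R - real m) * R)"
proof -
  have "cmod (rice_kernel m s) \<le> fact m / (R - real m)"
  proof (rule rice_kernel_bound)
    fix k assume "k \<le> m"
    moreover have "\<bar>Re (of_nat k - s)\<bar> \<le> cmod (of_nat k - s)" "\<bar>Im (of_nat k - s)\<bar> \<le> cmod (of_nat k - s)"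
      by (rule abs_Re_le_cmod, rule abs_Im_le_cmod)
    ultimately show "R - real m \<le> cmod (of_nat k - s)" using s by auto
  qed (use R in auto)
  \<comment> \<open>The constant C = K + 3 of \<open>Psi_ge_strip\<close> comes from (R + 1) + K + R
    \<le> (K + 3) R for R \<ge> 1; on the right side the bound 1/2 is better still.\<close>
  moreover have "cmod (inv_Psi (s + 1)) \<le> 1 / (1 / ((real K + 3)\<^sup>2 + 1))"
  proof (rule norm_inv_Psi_le)
    show "0 < 1 / ((real K + 3)\<^sup>2 + 1)" by (simp add: add_nonneg_pos)
    show "1 / ((real K + 3)\<^sup>2 + 1) \<le> cmod (Psi (s + 1))"
    proof (cases "Re s = R")
      case True
      have "(1 :: real) \<le> (real K + 3)\<^sup>2" by (rule one_le_power) simp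
      then have "1 / ((real K + 3)\<^sup>2 + 1) \<le> 1 / 2"
        by (intro divide_left_mono mult_pos_pos) linarith+
      also have "\<dots> \<le> cmod (Psi (s + 1))" using True R by (intro Psi_ge_right) auto
      finally show ?thesis .
    next
      case False
      have "real K * 1 \<le> real K * R" using R by (intro mult_left_mono) auto
      then show ?thesis using False s R
        by (intro Psi_ge_strip[of _ K]) (auto simp: algebra_simps)
    qed
  qed
  moreover have "R \<le> cmod s" using s abs_Re_le_cmod[of s] abs_Im_le_cmod[of s] by auto
  ultimately have "cmod (rice m s) \<le> fact m / (R - real m) * (1 / (1 / ((real K + 3)\<^sup>2 + 1))) / R"
    unfolding rice_def norm_divide norm_mult using R by (intro frac_le mult_mono) auto
  then show ?thesis by simp
qed

lemma prod_shift_fact: "(\<Prod>k=1..m. real (k + a)) = fact (m + a) / fact a"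
  by (induction m) (auto simp: algebra_simps)

text \<open>The factors k = 1, ..., m of the kernel are at least k + K + 1 in modulus and yield the
  factorial quotient, which carries the decay in m. The factor k = 0 joins the 1 / s of the
  integrand to give |s|^(-2), which is integrable along the line.\<close>

lemma rice_bound_left:
  assumes "Re s = - (real K + 1)"
  shows "cmod (rice m s) \<le> 2 * (fact m * fact (K + 1) / fact (m + (K + 1))) / (1 + (Im s)\<^sup>2)"
proof -
  let ?Q = "fact (m + (K + 1)) / fact (K + 1) :: real"
  have s: "1 + (Im s)\<^sup>2 \<le> cmod s * cmod s"
  proof -
    have "(1 :: real) \<le> (real K + 1)\<^sup>2" by (rule one_le_power) simp
    then have "1 + (Im s)\<^sup>2 \<le> (Re s)\<^sup>2 + (Im s)\<^sup>2" unfolding assms power2_minus by simp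
    also have "\<dots> = cmod s * cmod s" by (metis cmod_power2 power2_eq_square)
    finally show ?thesis .
  qed
  have s0: "cmod s > 0" using assms by auto
  have "cmod s * ?Q \<le> (\<Prod>k\<le>m. cmod (of_nat k - s))"
  proof -
    have "{..m} = insert 0 {1..m}" by auto
    then have split: "(\<Prod>k\<le>m. cmod (of_nat k - s)) = cmod s * (\<Prod>k=1..m. cmod (of_nat k - s))"
      by simp
    have "?Q \<le> (\<Prod>k=1..m. cmod (of_nat k - s))"
      unfolding prod_shift_fact[symmetric]
    proof (intro prod_mono conjI)
      fix k
      show "real (k + (K + 1)) \<le> cmod (of_nat k - s)"
        using assms abs_Re_le_cmod[of "of_nat k - s"] by simp
    qed auto
    then show ?thesis unfolding split by (rule mult_left_mono) simp
  qed
  then have "cmod (rice_kernel m s) \<le> fact m / (cmod s * ?Q)"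
    unfolding rice_kernel_def norm_divide prod_norm[symmetric] norm_fact using s0
    by (intro divide_left_mono mult_pos_pos) (auto intro: less_le_trans[of _ "cmod s * ?Q"])
  moreover have "cmod (inv_Psi (s + 1)) \<le> 1 / (1 / 2)"
  proof (rule norm_inv_Psi_le)
    \<comment> \<open>The line meets the real axis only where s + 1 = -K, and there
      \<open>inv_Psi\<close> is 0.\<close>
    assume nz: "s + 1 \<notin> \<int>\<^sub>\<le>\<^sub>0"
    have "Im s \<noteq> 0"
    proof
      assume "Im s = 0"
      then have "s + 1 = - of_nat K" using assms by (simp add: complex_eq_iff)
      with nz show False by simp
    qed
    then show "1 / 2 \<le> cmod (Psi (s + 1))" using assms by (intro Psi_ge_left) auto
  qed simp
  ultimately have "cmod (rice m s) \<le> fact m / (cmod s * ?Q) * (1 / (1 / 2)) / cmod s"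
    unfolding rice_def norm_divide norm_mult by (intro divide_right_mono mult_mono) auto
  also have "\<dots> = 2 * (fact m * fact (K + 1) / fact (m + (K + 1))) / (cmod s * cmod s)"
    by (simp add: mult_ac)
  also have "\<dots> \<le> 2 * (fact m * fact (K + 1) / fact (m + (K + 1))) / (1 + (Im s)\<^sup>2)"
    using s s0 by (intro divide_left_mono mult_pos_pos) (auto simp: add_pos_nonneg)
  finally show ?thesis .
qed

text \<open>The majorant integrates to an arctangent, so the bound is independent of the length of
  the segment.\<close>

lemma contour_integral_vertical_bound:
  assumes cont: "continuous_on (closed_segment (Complex c R) (Complex c (- R))) f"
    and R: "R \<ge> 0" and b: "b \<ge> 0"
    and f: "\<And>s. Re s = c \<Longrightarrow> cmod (f s) \<le> b / (1 + (Im s)\<^sup>2)"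
  shows "cmod (contour_integral (linepath (Complex c R) (Complex c (- R))) f) \<le> b * pi"
proof -
  let ?p = "linepath (Complex c R) (Complex c (- R))"
  have lp: "?p x = Complex c (R - 2 * R * x)" for x
    by (simp add: linepath_def complex_eq_iff algebra_simps)
  have diff: "Complex c (- R) - Complex c R = Complex 0 (- 2 * R)"
    by (simp add: complex_eq_iff)
  have int: "f contour_integrable_on ?p" by (rule contour_integrable_continuous_linepath[OF cont])
  then have "(f has_contour_integral contour_integral ?p f) ?p" by (rule has_contour_integral_integral)
  then have I: "((\<lambda>x. f (?p x) * Complex 0 (- 2 * R)) has_integral contour_integral ?p f) {0..1}"
    unfolding has_contour_integral_linepath diff .
  have G: "((\<lambda>x. b / (1 + (R - 2 * R * x)\<^sup>2) * (2 * R)) has_integral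
      (- b * arctan (R - 2 * R * 1) - (- b * arctan (R - 2 * R * 0)))) {0..1}"
    by (intro fundamental_theorem_of_calculus)
      (auto intro!: derivative_eq_intros simp: has_real_derivative_iff_has_vector_derivative[symmetric] divide_inverse)
  have bnd: "cmod (f (?p x) * Complex 0 (- 2 * R)) \<le> b / (1 + (R - 2 * R * x)\<^sup>2) * (2 * R)" for x
  proof -
    have "cmod (Complex 0 (- 2 * R)) = 2 * R" using R by (simp add: cmod_def real_sqrt_mult)
    moreover have "cmod (f (?p x)) \<le> b / (1 + (R - 2 * R * x)\<^sup>2)"
      using f[of "?p x"] by (simp add: lp)
    ultimately show ?thesis using R by (simp only: norm_mult) (intro mult_right_mono, auto)
  qed
  have "cmod (contour_integral ?p f) = cmod (integral {0..1} (\<lambda>x. f (?p x) * Complex 0 (- 2 * R)))"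
    using integral_unique[OF I] by simp
  also have "\<dots> \<le> integral {0..1} (\<lambda>x. b / (1 + (R - 2 * R * x)\<^sup>2) * (2 * R))"
    by (intro integral_norm_bound_integral has_integral_integrable[OF I] has_integral_integrable[OF G] bnd)
  also have "\<dots> = - b * arctan (R - 2 * R * 1) - (- b * arctan (R - 2 * R * 0))"
    by (rule integral_unique[OF G])
  also have "\<dots> = b * (2 * arctan R)" by (simp add: arctan_minus algebra_simps)
  also have "\<dots> \<le> b * pi" using arctan_ubound[of R] b by (intro mult_left_mono) auto
  finally show ?thesis .
qed

lemma rice_contour_bound:
  assumes R: "R \<ge> real m + 1" "R \<ge> real K + 1"
  defines "a \<equiv> Complex (- (real K + 1)) (- R)" and "b \<equiv> Complex R R"
  assumes cont: "continuous_on (path_image (rectpath a b)) (rice m)"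
  shows "cmod (contour_integral (rectpath a b) (rice m)) \<le>
    2 * (fact m * fact (K + 1) / fact (m + (K + 1))) * pi + 6 * (fact m * ((real K + 3)\<^sup>2 + 1)) / (R - real m)"
proof -
  define M :: real where "M = fact m * ((real K + 3)\<^sup>2 + 1)"
  define c where "c = Complex R (- R)"
  define d where "d = Complex (- (real K + 1)) R"
  have rect: "rectpath a b = linepath a c +++ linepath c b +++ linepath b d +++ linepath d a"
    by (simp add: rectpath_def Let_def a_def b_def c_def d_def)
  have img: "path_image (rectpath a b) = closed_segment a c \<union> closed_segment c b \<union> closed_segment b d \<union> closed_segment d a"
    unfolding rect by (auto simp: path_image_join)
  have con: "continuous_on (closed_segment u v) (rice m)" if "closed_segment u v \<subseteq> path_image (rectpath a b)" for u v
    using continuous_on_subset[OF cont that] .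
  have conts: "continuous_on (closed_segment a c) (rice m)" "continuous_on (closed_segment c b) (rice m)"
    "continuous_on (closed_segment b d) (rice m)" "continuous_on (closed_segment d a) (rice m)"
    by (intro con; auto simp: img)+
  note ints = conts[THEN contour_integrable_continuous_linepath]
  have split: "contour_integral (rectpath a b) (rice m) = contour_integral (linepath a c) (rice m)
      + (contour_integral (linepath c b) (rice m) + (contour_integral (linepath b d) (rice m)
      + contour_integral (linepath d a) (rice m)))"
    unfolding rect by (simp add: ints)
  have side: "cmod (contour_integral (linepath u v) (rice m)) \<le> 2 * M / (R - real m)"
    if "rice m contour_integrable_on linepath u v" "cmod (v - u) \<le> 2 * R"
      "\<And>s. s \<in> closed_segment u v \<Longrightarrow> \<bar>Im s\<bar> = R \<and> - (real K + 1) \<le> Re s \<and> Re s \<le> R \<or> Re s = R" for u v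
  proof -
    have M0: "0 \<le> M / ((R - real m) * R)" using R by (simp add: M_def)
    have "cmod (contour_integral (linepath u v) (rice m)) \<le> M / ((R - real m) * R) * cmod (v - u)"
      using that rice_bound_far[OF R] M0 unfolding M_def by (intro contour_integral_bound_linepath) auto
    also have "\<dots> \<le> M / ((R - real m) * R) * (2 * R)" using M0 that by (intro mult_left_mono)
    also have "\<dots> = 2 * M / (R - real m)" using R by simp
    finally show ?thesis .
  qed
  have len: "cmod (c - a) \<le> 2 * R" "cmod (b - c) \<le> 2 * R" "cmod (d - b) \<le> 2 * R"
    using R by (simp_all add: a_def b_def c_def d_def cmod_def real_sqrt_mult)
  have 1: "cmod (contour_integral (linepath a c) (rice m)) \<le> 2 * M / (R - real m)"
    by (rule side) (use R ints len in \<open>auto simp: a_def c_def closed_segment_same_Im closed_segment_eq_real_ivl\<close>)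
  have 2: "cmod (contour_integral (linepath c b) (rice m)) \<le> 2 * M / (R - real m)"
    by (rule side) (use R ints len in \<open>auto simp: b_def c_def closed_segment_same_Re closed_segment_eq_real_ivl\<close>)
  have 3: "cmod (contour_integral (linepath b d) (rice m)) \<le> 2 * M / (R - real m)"
    by (rule side) (use R ints len in \<open>auto simp: b_def d_def closed_segment_same_Im closed_segment_eq_real_ivl\<close>)
  have 4: "cmod (contour_integral (linepath d a) (rice m)) \<le> 2 * (fact m * fact (K + 1) / fact (m + (K + 1))) * pi"
    unfolding d_def a_def
  proof (rule contour_integral_vertical_bound)
    show "continuous_on (closed_segment (Complex (- (real K + 1)) R) (Complex (- (real K + 1)) (- R))) (rice m)"
      using conts(4) by (simp add: d_def a_def)
  qed (use R rice_bound_left in auto)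
  have "cmod (contour_integral (rectpath a b) (rice m)) \<le> 2 * M / (R - real m) + (2 * M / (R - real m)
      + (2 * M / (R - real m) + 2 * (fact m * fact (K + 1) / fact (m + (K + 1))) * pi))"
    unfolding split by (intro norm_triangle_mono 1 2 3 4)
  then show ?thesis unfolding M_def[symmetric] by (simp add: add_divide_distrib[symmetric])
qed

text \<open>Let R tend to infinity with m and K fixed: only the left side survives. The 2 from 1 /
  |Psi| \<le> 2 and the pi from the arctangent cancel the 2 pi of the residue theorem.\<close>

lemma rice_residue_sum_bound:
  "cmod (\<Sum>p\<in>rice_poles m K. residue (rice m) p) \<le> fact m * fact (K + 1) / fact (m + (K + 1))"
proof -
  define S where "S = (\<Sum>p\<in>rice_poles m K. residue (rice m) p)"
  define B :: real where "B = fact m * fact (K + 1) / fact (m + (K + 1))"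
  define M :: real where "M = fact m * ((real K + 3)\<^sup>2 + 1)"
  have M0: "M > 0" by (auto simp: M_def intro!: mult_pos_pos add_nonneg_pos)
  have main: "2 * pi * cmod S \<le> 2 * B * pi + 6 * M / (R - real m)" if R: "R \<ge> real m + 1" "R \<ge> real K + 1" for R
  proof -
    define a where "a = Complex (- (real K + 1)) (- R)"
    define b where "b = Complex R R"
    have le: "Re a \<le> Re b" "Im a \<le> Im b" using R by (auto simp: a_def b_def)
    have sub: "cbox a b \<subseteq> rice_domain K"
      using neg_root(2)[of K] by (auto simp: in_cbox_complex_iff rice_domain_def a_def)
    have poles: "rice_poles m K \<subseteq> box a b"
    proof
      fix p assume "p \<in> rice_poles m K"
      then consider j where "j \<le> m" "p = of_nat j" | i where "i < K" "p = of_real (neg_root (Suc i)) - 1"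
        by (auto simp: rice_poles_def)
      then show "p \<in> box a b"
      proof cases
        case 1
        then show ?thesis using R by (auto simp: in_box_complex_iff a_def b_def)
      next
        case 2
        then show ?thesis using R neg_root[of i] by (auto simp: in_box_complex_iff a_def b_def)
      qed
    qed
    have img: "path_image (rectpath a b) \<subseteq> rice_domain K - rice_poles m K"
      using poles sub unfolding path_image_rectpath_cbox_minus_box[OF le] by auto
    have "contour_integral (rectpath a b) (rice m) =
        2 * pi * \<i> * (\<Sum>p\<in>rice_poles m K. winding_number (rectpath a b) p * residue (rice m) p)"
    proof (rule Residue_theorem[OF open_rice_domain _ finite_rice_poles rice_holomorphic _ _ img])
      show "connected (rice_domain K)"
        unfolding rice_domain_def by (intro convex_connected convex_halfspace_Re_gt)
      show "\<forall>z. z \<notin> rice_domain K \<longrightarrow> winding_number (rectpath a b) z = 0"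
        using sub le by (auto intro!: winding_number_rectpath_outside)
    qed auto
    also have "(\<Sum>p\<in>rice_poles m K. winding_number (rectpath a b) p * residue (rice m) p) = S"
      unfolding S_def using poles by (intro sum.cong) (auto simp: winding_number_rectpath)
    finally have "2 * pi * cmod S = cmod (contour_integral (rectpath a b) (rice m))"
      by (simp add: norm_mult)
    also have "\<dots> \<le> 2 * B * pi + 6 * M / (R - real m)"
      unfolding a_def b_def B_def M_def
      by (intro rice_contour_bound R holomorphic_on_imp_continuous_on holomorphic_on_subset[OF rice_holomorphic[of m K]]
          img[unfolded a_def b_def])
    finally show ?thesis .
  qed
  have "2 * pi * cmod S \<le> 2 * B * pi"
  proof (rule field_le_epsilon)
    fix e :: real assume e: "e > 0"
    \<comment> \<open>Chosen so that the three far sides together contribute at most e.\<close>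
    define R where "R = real m + real K + 1 + 6 * M / e"
    have R: "6 * M / e \<le> R - real m" "R \<ge> real m + 1" "R \<ge> real K + 1"
      using e M0 by (auto simp: R_def)
    have "6 * M \<le> e * (R - real m)" using R(1) e by (simp add: field_simps)
    then have "6 * M / (R - real m) \<le> e" using R by (simp add: field_simps)
    with main[OF R(2,3)] show "2 * pi * cmod S \<le> 2 * B * pi + e" by linarith
  qed
  then have "pi * cmod S \<le> pi * B" by simp
  then have "cmod S \<le> B" using pi_gt_zero by (simp only: mult_le_cancel_left_pos)
  then show ?thesis unfolding S_def B_def .
qed

theorem exp_L_approx:
  "\<bar>exp_L (Suc m) - (((harm m)\<^sup>2 + (\<Sum>k=1..m. 1 / real k ^ 2)) / 2 / zeta_nat 2
     + zeta_nat 3 / zeta_nat 2 ^ 2 * harm m + zeta_nat 3 ^ 2 / zeta_nat 2 ^ 3 - zeta_nat 4 / zeta_nat 2 ^ 2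
     + (\<Sum>i<K. fact m / (\<Prod>k\<le>m. real k + (1 - neg_root (Suc i))) / ((1 - neg_root (Suc i)) * Polygamma 1 (neg_root (Suc i)))))\<bar>
   \<le> fact m * fact (K + 1) / fact (m + (K + 1))"
proof -
  define r0 where "r0 = (((harm m)\<^sup>2 + (\<Sum>k=1..m. 1 / real k ^ 2)) / 2 / zeta_nat 2
     + zeta_nat 3 / zeta_nat 2 ^ 2 * harm m + zeta_nat 3 ^ 2 / zeta_nat 2 ^ 3 - zeta_nat 4 / zeta_nat 2 ^ 2)"
  define t where "t i = fact m / (\<Prod>k\<le>m. real k + (1 - neg_root (Suc i))) / ((1 - neg_root (Suc i)) * Polygamma 1 (neg_root (Suc i)))" for i
  let ?r = "\<lambda>i. complex_of_real (neg_root (Suc i)) - 1"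
  have inj: "inj_on ?r {..<K}"
  proof (rule inj_onI)
    fix i j assume "?r i = ?r j"
    then have "neg_root (Suc i) = neg_root (Suc j)" by simp
    then show "i = j" using neg_root_less[of i j] neg_root_less[of j i] by (cases i j rule: linorder_cases) auto
  qed
  have "?r i \<noteq> of_nat j" for i j
  proof
    assume "?r i = of_nat j"
    then have "Re (?r i) = Re (of_nat j)" by (simp only:)
    with neg_root(2)[of i] show False by simp
  qed
  then have disj: "of_nat ` {..m} \<inter> ?r ` {..<K} = {}" by (auto simp: eq_commute)
  have "(\<Sum>p\<in>rice_poles m K. residue (rice m) p) =
      (\<Sum>j\<le>m. residue (rice m) (of_nat j)) + (\<Sum>i<K. residue (rice m) (?r i))"
    unfolding rice_poles_def
    by (subst sum.union_disjoint[OF _ _ disj]) (auto simp: sum.reindex inj inj_on_def sum.reindex[OF inj])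
  also have "(\<Sum>j\<le>m. residue (rice m) (of_nat j)) = residue (rice m) 0 + (\<Sum>j=1..m. residue (rice m) (of_nat j))"
  proof -
    have "{..m} = insert 0 {1..m}" by auto
    then show ?thesis by simp
  qed
  also have "(\<Sum>j=1..m. residue (rice m) (of_nat j)) = of_real (exp_L (Suc m))"
    unfolding exp_L_eq of_real_sum by (intro sum.cong refl rice_residue_of_nat) auto
  also have "residue (rice m) 0 = of_real (- r0)" unfolding r0_def rice_residue_0 by simp
  also have "(\<Sum>i<K. residue (rice m) (?r i)) = (\<Sum>i<K. of_real (- t i))"
    unfolding rice_residue_neg_root t_def by simp
  finally have "(\<Sum>p\<in>rice_poles m K. residue (rice m) p) = of_real (exp_L (Suc m) - (r0 + (\<Sum>i<K. t i)))"
    by (simp add: sum_negf)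
  then have "\<bar>exp_L (Suc m) - (r0 + (\<Sum>i<K. t i))\<bar> = cmod (\<Sum>p\<in>rice_poles m K. residue (rice m) p)"
    by (simp only: norm_of_real)
  also have "\<dots> \<le> fact m * fact (K + 1) / fact (m + (K + 1))" by (rule rice_residue_sum_bound)
  finally show ?thesis unfolding r0_def t_def .
qed

section \<open>Asymptotics\<close>

lemma Polygamma_1_real: "Polygamma 1 (1 :: real) = zeta_nat 2"
proof -
  have "(\<lambda>k. inverse ((1 + real k) ^ Suc 1)) sums ((-1) ^ Suc 1 * Polygamma 1 1 / fact 1)"
    by (rule Polygamma_LIMSEQ) auto
  then have "(\<lambda>k. 1 / real (Suc k) ^ 2) sums Polygamma 1 1"
    by (simp add: numeral_2_eq_2 inverse_eq_divide)
  then show ?thesis using zeta_nat_sums[of 2] sums_unique2 by blast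
qed

lemma Polygamma_1_of_nat: "Polygamma 1 (real (Suc m)) = zeta_nat 2 - (\<Sum>k=1..m. 1 / real k ^ 2)"
proof -
  have "Polygamma 1 (1 + real m) = zeta_nat 2 - (\<Sum>k<m. 1 / (1 + real k) ^ 2)"
    by (subst Polygamma_plus_of_nat) (auto simp: Polygamma_1_real[simplified] numeral_2_eq_2)
  moreover have "(\<Sum>k<m. 1 / (1 + real k) ^ 2) = (\<Sum>k=1..m. 1 / real k ^ 2)"
    by (rule sum.reindex_bij_witness[of _ "\<lambda>k. k - 1" Suc]) auto
  ultimately show ?thesis by (simp add: add.commute)
qed

lemma Polygamma_1_upper:
  assumes "x > (1 :: real)"
  shows "Polygamma 1 x \<le> 1 / (x - 1)"
proof -
  have "(\<lambda>k. inverse ((x + real k) ^ Suc 1)) sums ((-1) ^ Suc 1 * Polygamma 1 x / fact 1)"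
    using assms by (intro Polygamma_LIMSEQ) auto
  then have P: "(\<lambda>k. 1 / (x + real k)\<^sup>2) sums Polygamma 1 x"
    by (simp add: numeral_2_eq_2 inverse_eq_divide)
  have "(\<lambda>k. 1 / (x - 1 + real k) - 1 / (x - 1 + real (Suc k))) sums (1 / (x - 1 + real 0) - 0)"
    by (rule telescope_sums') real_asymp
  then have T: "(\<lambda>k. 1 / (x - 1 + real k) - 1 / (x + real k)) sums (1 / (x - 1))"
    by (simp add: algebra_simps)
  show ?thesis
  proof (rule sums_le[OF _ P T])
    fix k
    have "1 / (x - 1 + real k) - 1 / (x + real k) = 1 / ((x - 1 + real k) * (x + real k))"
      using assms by (simp add: field_simps)
    also have "\<dots> \<ge> 1 / ((x + real k) * (x + real k))"
      using assms by (intro divide_left_mono mult_right_mono mult_pos_pos) auto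
    finally show "1 / (x + real k)\<^sup>2 \<le> 1 / (x - 1 + real k) - 1 / (x + real k)"
      by (simp add: power2_eq_square)
  qed
qed

text \<open>Gauss's limit: \<open>Gamma_series' a n\<close> tends to Gamma a, and divided by Gamma a
  it is the quotient times n^a.\<close>

lemma Gamma_ratio_bigo:
  assumes "a > (0 :: real)"
  shows "(\<lambda>n. Gamma (real n) / Gamma (real n + a)) \<in> O(\<lambda>n. real n powr - a)"
proof (rule bigoI_tendsto)
  have a: "a \<notin> \<int>\<^sub>\<le>\<^sub>0" using assms by (auto elim!: nonpos_Ints_cases)
  have "(\<lambda>n. Gamma_series' a n / Gamma a) \<longlonglongrightarrow> Gamma a / Gamma a"
    using a by (intro tendsto_intros Gamma_series'_LIMSEQ) (auto simp: Gamma_eq_zero_iff)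
  moreover have "\<forall>\<^sub>F n in sequentially. Gamma_series' a n / Gamma a = Gamma (real n) / Gamma (real n + a) / real n powr - a"
    using eventually_gt_at_top[of 0]
  proof eventually_elim
    case (elim n)
    have "Gamma (real n) = fact (n - 1)" using Gamma_fact[of "n - 1"] elim by (simp add: of_nat_diff)
    then show ?case
      using elim a by (simp add: Gamma_series'_def pochhammer_Gamma powr_def exp_minus Gamma_eq_zero_iff add.commute field_simps)
  qed
  ultimately show "(\<lambda>n. Gamma (real n) / Gamma (real n + a) / real n powr - a) \<longlonglongrightarrow> Gamma a / Gamma a"
    by (rule Lim_transform_eventually)
  show "\<forall>\<^sub>F n in sequentially. real n powr - a \<noteq> 0"
    using eventually_gt_at_top[of 0] by eventually_elim auto
qed

lemma harm_ln_bound: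
  assumes "n \<ge> 2"
  shows "\<bar>harm (n - 1) - ln (real n) - euler_mascheroni\<bar> \<le> 1 / real n"
proof -
  \<comment> \<open>With n = k + 2 the difference harm (n - 1) - ln n takes exactly the shape of the
    known two-sided bounds for Euler's constant.\<close>
  define k where "k = n - 2"
  have k: "n = k + 2" using assms by (simp add: k_def)
  have lower: "harm (Suc k) - ln (real (k + 2)) \<le> euler_mascheroni"
    using euler_mascheroni_lower[of k] by (rule order.trans[rotated]) simp
  have "euler_mascheroni \<le> harm (Suc k) - ln (real (k + 2)) + 1 / real (2 * (k + 1))"
    by (rule euler_mascheroni_upper)
  also have "1 / real (2 * (k + 1)) \<le> 1 / real (k + 2)"
    by (intro divide_left_mono mult_pos_pos) auto
  finally have upper: "euler_mascheroni \<le> harm (Suc k) - ln (real (k + 2)) + 1 / real (k + 2)" by simp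
  have "n - 1 = Suc k" "0 \<le> 1 / real (k + 2)" by (simp_all add: k)
  then show ?thesis using lower upper unfolding abs_le_iff k by simp
qed

definition L_main :: "nat \<Rightarrow> real" where
  "L_main n = 3 / pi\<^sup>2 * (harm (n - 1))\<^sup>2 + zeta_nat 3 / (zeta_nat 2)\<^sup>2 * harm (n - 1)
    + (zeta_nat 3)\<^sup>2 / (zeta_nat 2) ^ 3 + 1 / 10 - 3 / pi\<^sup>2 * Polygamma 1 (real n)"

definition L_term :: "nat \<Rightarrow> nat \<Rightarrow> real" where
  "L_term i n = Gamma (\<bar>neg_root i\<bar> + 1) / ((\<bar>neg_root i\<bar> + 1) * Polygamma 1 (neg_root i))
                  * (Gamma (real n) / Gamma (real n + \<bar>neg_root i\<bar> + 1))"

lemma exp_L_expansion_bound: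
  "\<bar>exp_L (Suc m) - (L_main (Suc m) + (\<Sum>i=1..K. L_term i (Suc m)))\<bar> \<le> fact m * fact (K + 1) / fact (m + (K + 1))"
proof -
  \<comment> \<open>Origin of the constant: 1/10 = 1/2 - 2/5. The 1/2 appears when the sum of 1 /
    k^2 is replaced by zeta(2) - psi'(m + 1), and 2/5 is zeta(4) / zeta(2)^2.\<close>
  have main: "L_main (Suc m) = ((harm m)\<^sup>2 + (\<Sum>k=1..m. 1 / real k ^ 2)) / 2 / zeta_nat 2
     + zeta_nat 3 / zeta_nat 2 ^ 2 * harm m + zeta_nat 3 ^ 2 / zeta_nat 2 ^ 3 - zeta_nat 4 / zeta_nat 2 ^ 2"
  proof -
    have "zeta_nat 4 / zeta_nat 2 ^ 2 = 2 / 5"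
      unfolding zeta_nat_2 zeta_nat_4 by (simp add: power_divide flip: power_mult)
    moreover have "(x + y) / 2 / zeta_nat 2 = 3 / pi\<^sup>2 * x + 3 / pi\<^sup>2 * y" for x y
      unfolding zeta_nat_2 by (simp add: field_simps)
    moreover have "3 / pi\<^sup>2 * Polygamma 1 (real (Suc m)) = 1 / 2 - 3 / pi\<^sup>2 * (\<Sum>k=1..m. 1 / real k ^ 2)"
      unfolding Polygamma_1_of_nat zeta_nat_2 right_diff_distrib by simp
    ultimately show ?thesis unfolding L_main_def by (simp only:) simp
  qed
  have "L_term (Suc i) (Suc m) = fact m / (\<Prod>k\<le>m. real k + (1 - neg_root (Suc i))) /
      ((1 - neg_root (Suc i)) * Polygamma 1 (neg_root (Suc i)))" for i
  proof -
    define z where "z = 1 - neg_root (Suc i)"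
    have z: "z > 1" "\<bar>neg_root (Suc i)\<bar> + 1 = z"
      using neg_root(2)[of i] by (auto simp: z_def)
    have "(\<Prod>k\<le>m. real k + z) = pochhammer z (Suc m)"
      by (simp only: pochhammer_prod lessThan_Suc_atMost add.commute atLeast0LessThan)
    also have "\<dots> = Gamma (z + real (Suc m)) / Gamma z"
      using z by (intro pochhammer_Gamma) (auto elim!: nonpos_Ints_cases)
    finally have p: "(\<Prod>k\<le>m. real k + z) = Gamma (real (Suc m) + z) / Gamma z" by (simp add: add.commute)
    have g: "Gamma (real (Suc m)) = fact m" using Gamma_fact[of m] by simp
    show ?thesis
      unfolding L_term_def add.assoc z(2) g z_def[symmetric] p by (simp add: mult_ac)
  qed
  then have "(\<Sum>i=1..K. L_term i (Suc m)) = (\<Sum>i<K. fact m / (\<Prod>k\<le>m. real k + (1 - neg_root (Suc i))) /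
      ((1 - neg_root (Suc i)) * Polygamma 1 (neg_root (Suc i))))"
    unfolding One_nat_def sum.atLeast1_atMost_eq by (intro sum.cong refl)
  with exp_L_approx[of m K] show ?thesis unfolding main by simp
qed

lemma fact_ratio_le: "fact m / fact (m + k) \<le> (1 :: real) / real (Suc m) ^ k"
proof (induction k)
  case (Suc k)
  have "fact m / fact (m + Suc k) = (fact m / fact (m + k)) * (1 / real (Suc (m + k)))"
    by simp
  also have "\<dots> \<le> (1 / real (Suc m) ^ k) * (1 / real (Suc m))"
    by (intro mult_mono Suc.IH divide_left_mono) auto
  finally show ?case by (simp add: mult.commute)
qed simp

lemma bigo_const_mult_left:
  fixes f g :: "'a \<Rightarrow> real"
  assumes "f \<in> O[F](g)"
  shows "(\<lambda>x. c * f x) \<in> O[F](g)"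
  using assms by (cases "c = 0") auto

text \<open>Since N < |s_(N+1)| < N + 1, the bound with N roots, of order n^-(N+1), is too weak.
  With N + 1 roots the error is of order n^-(N+2), which suffices, and the surplus term has exactly
  the claimed order.\<close>

lemma exp_L_expansion:
  "(\<lambda>n. exp_L n - (L_main n + (\<Sum>i=1..N. L_term i n))) \<in> O(\<lambda>n. real n powr (- 1 - \<bar>neg_root (N + 1)\<bar>))"
proof -
  have root: "\<bar>neg_root (N + 1)\<bar> < real N + 1" "\<bar>neg_root (N + 1)\<bar> \<ge> 0"
    using neg_root[of N] by auto
  have "(\<lambda>n. exp_L n - (L_main n + (\<Sum>i=1..Suc N. L_term i n))) \<in> O(\<lambda>n. real n powr (- 1 - \<bar>neg_root (N + 1)\<bar>))"
  proof (rule bigoI[where c = "fact (N + 2)"], rule eventually_mono[OF eventually_gt_at_top[of 0]])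
    fix n :: nat assume "n > 0"
    then obtain m where n: "n = Suc m" by (cases n) auto
    have "\<bar>exp_L n - (L_main n + (\<Sum>i=1..Suc N. L_term i n))\<bar> \<le> fact (N + 2) * (fact m / fact (m + (N + 2)))"
      using exp_L_expansion_bound[of m "Suc N"] unfolding n by (simp add: mult.commute)
    also have "\<dots> \<le> fact (N + 2) * (1 / real n ^ (N + 2))"
      unfolding n by (intro mult_left_mono fact_ratio_le) auto
    also have "1 / real n ^ (N + 2) = real n powr (- real (N + 2))"
      using \<open>n > 0\<close> by (simp only: powr_minus powr_realpow of_nat_0_less_iff inverse_eq_divide)
    also have "\<dots> \<le> real n powr (- 1 - \<bar>neg_root (N + 1)\<bar>)"
      using root \<open>n > 0\<close> by (intro powr_mono) auto
    finally show "norm (exp_L n - (L_main n + (\<Sum>i=1..Suc N. L_term i n))) \<le> fact (N + 2) * norm (real n powr (- 1 - \<bar>neg_root (N + 1)\<bar>))"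
      by simp
  qed
  moreover have "L_term (Suc N) \<in> O(\<lambda>n. real n powr (- 1 - \<bar>neg_root (N + 1)\<bar>))"
  proof -
    have "- (\<bar>neg_root (N + 1)\<bar> + 1) = - 1 - \<bar>neg_root (N + 1)\<bar>" by simp
    moreover have "0 < \<bar>neg_root (N + 1)\<bar> + 1" using root by simp
    ultimately have "(\<lambda>n. Gamma (real n) / Gamma (real n + (\<bar>neg_root (N + 1)\<bar> + 1)))
        \<in> O(\<lambda>n. real n powr (- 1 - \<bar>neg_root (N + 1)\<bar>))"
      using Gamma_ratio_bigo[of "\<bar>neg_root (N + 1)\<bar> + 1"] by metis
    then show ?thesis
      unfolding L_term_def Suc_eq_plus1 add.assoc by (rule bigo_const_mult_left)
  qed
  ultimately have "(\<lambda>n. (exp_L n - (L_main n + (\<Sum>i=1..Suc N. L_term i n))) + L_term (Suc N) n)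
      \<in> O(\<lambda>n. real n powr (- 1 - \<bar>neg_root (N + 1)\<bar>))"
    by (rule sum_in_bigo)
  then show ?thesis by (simp add: algebra_simps)
qed

lemma L_main_bigo:
  "(\<lambda>n. L_main n - ( 3 / pi\<^sup>2 * (ln (real n))\<^sup>2
          + (zeta_nat 3 / (zeta_nat 2)\<^sup>2 + euler_mascheroni / zeta_nat 2) * ln (real n)
          + ( 3 * euler_mascheroni\<^sup>2 / pi\<^sup>2 + zeta_nat 3 / (zeta_nat 2)\<^sup>2 * euler_mascheroni
              + (zeta_nat 3)\<^sup>2 / (zeta_nat 2) ^ 3 + 1 / 10)))
     \<in> O(\<lambda>n. ln (real n) / real n)"
proof -
  \<comment> \<open>With harm (n - 1) = ln n + gamma + d, the square differs from (ln n + gamma)^2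
    by d (2 (ln n + gamma) + d). As d is O(1/n), this product is the source of the error ln n /
    n.\<close>
  define d where "d n = harm (n - 1) - ln (real n) - euler_mascheroni" for n
  have d: "d \<in> O(\<lambda>n. 1 / real n)"
    unfolding d_def
    by (rule bigoI[of _ 1], rule eventually_mono[OF eventually_ge_at_top[of 2]]) (use harm_ln_bound in auto)
  have inv: "(\<lambda>n. 1 / real n) \<in> O(\<lambda>n. ln (real n) / real n)" by real_asymp
  have d1: "d \<in> O(\<lambda>n. ln (real n) / real n)" using d inv by (rule landau_o.big_trans)
  have P: "(\<lambda>n. Polygamma 1 (real n)) \<in> O(\<lambda>n. ln (real n) / real n)"
  proof (rule landau_o.big_trans[OF _ inv], rule bigoI[of _ 2], rule eventually_mono[OF eventually_ge_at_top[of 2]])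
    fix n :: nat assume n: "n \<ge> 2"
    have "real n \<notin> \<int>\<^sub>\<le>\<^sub>0" using n by (auto elim!: nonpos_Ints_cases)
    then have "Polygamma 1 (real n) > 0" by (intro Polygamma_real_odd_pos) auto
    moreover have "Polygamma 1 (real n) \<le> 1 / (real n - 1)" using n by (intro Polygamma_1_upper) auto
    moreover have "1 / (real n - 1) \<le> 2 / real n" using n by (simp add: field_simps)
    ultimately show "norm (Polygamma 1 (real n)) \<le> 2 * norm (1 / real n)" by simp
  qed
  have "(\<lambda>n. d n * (2 * (ln (real n) + euler_mascheroni) + d n)) \<in> O(\<lambda>n. (1 / real n) * ln (real n))"
  proof (intro landau_o.big.mult d sum_in_bigo)
    show "(\<lambda>n. 2 * (ln (real n) + euler_mascheroni)) \<in> O(\<lambda>n. ln (real n))" by real_asymp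
    have "(\<lambda>n. 1 / real n) \<in> O(\<lambda>n. ln (real n))" by real_asymp
    with d show "d \<in> O(\<lambda>n. ln (real n))" by (rule landau_o.big_trans)
  qed
  then have sq: "(\<lambda>n. d n * (2 * (ln (real n) + euler_mascheroni) + d n)) \<in> O(\<lambda>n. ln (real n) / real n)"
    by simp
  have "(\<lambda>n. 3 / pi\<^sup>2 * (d n * (2 * (ln (real n) + euler_mascheroni) + d n))
      + zeta_nat 3 / (zeta_nat 2)\<^sup>2 * d n - 3 / pi\<^sup>2 * Polygamma 1 (real n)) \<in> O(\<lambda>n. ln (real n) / real n)"
    by (intro sum_in_bigo bigo_const_mult_left sq d1 P)
  moreover have "L_main n - ( 3 / pi\<^sup>2 * (ln (real n))\<^sup>2
          + (zeta_nat 3 / (zeta_nat 2)\<^sup>2 + euler_mascheroni / zeta_nat 2) * ln (real n)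
          + ( 3 * euler_mascheroni\<^sup>2 / pi\<^sup>2 + zeta_nat 3 / (zeta_nat 2)\<^sup>2 * euler_mascheroni
              + (zeta_nat 3)\<^sup>2 / (zeta_nat 2) ^ 3 + 1 / 10))
      = 3 / pi\<^sup>2 * (d n * (2 * (ln (real n) + euler_mascheroni) + d n))
      + zeta_nat 3 / (zeta_nat 2)\<^sup>2 * d n - 3 / pi\<^sup>2 * Polygamma 1 (real n)" for n
  proof -
    have h: "harm (n - 1) = ln (real n) + euler_mascheroni + d n" by (simp add: d_def)
    have e: "euler_mascheroni / zeta_nat 2 = 2 * (3 / pi\<^sup>2) * euler_mascheroni"
      "3 * euler_mascheroni\<^sup>2 / pi\<^sup>2 = 3 / pi\<^sup>2 * euler_mascheroni\<^sup>2" by (simp_all add: zeta_nat_2)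
    show ?thesis unfolding L_main_def h e by (simp only: power2_eq_square ring_distribs) (simp add: algebra_simps)
  qed
  ultimately show ?thesis by simp
qed

theorem theorem8p1:
  shows "(\<forall>N::nat.
     (\<lambda>n::nat. exp_L n
        - ( 3 / pi\<^sup>2 * (harm (n - 1))\<^sup>2
          + zeta_nat 3 / (zeta_nat 2)\<^sup>2 * harm (n - 1)
          + (zeta_nat 3)\<^sup>2 / (zeta_nat 2) ^ 3
          + 1 / 10
          - 3 / pi\<^sup>2 * Polygamma 1 (real n)
          + (\<Sum>i = 1..N. Gamma (\<bar>neg_root i\<bar> + 1) / ((\<bar>neg_root i\<bar> + 1) * Polygamma 1 (neg_root i))
                          * (Gamma (real n) / Gamma (real n + \<bar>neg_root i\<bar> + 1)))))
     \<in> O(\<lambda>n. real n powr (- 1 - \<bar>neg_root (N + 1)\<bar>))) \<and>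
    (\<lambda>n::nat. exp_L n
        - ( 3 / pi\<^sup>2 * (ln (real n))\<^sup>2
          + (zeta_nat 3 / (zeta_nat 2)\<^sup>2 + euler_mascheroni / zeta_nat 2) * ln (real n)
          + ( 3 * euler_mascheroni\<^sup>2 / pi\<^sup>2 + zeta_nat 3 / (zeta_nat 2)\<^sup>2 * euler_mascheroni
              + (zeta_nat 3)\<^sup>2 / (zeta_nat 2) ^ 3 + 1 / 10)))
     \<in> O(\<lambda>n. ln (real n) / real n)"
proof (rule conjI)
  show "\<forall>N::nat.
     (\<lambda>n::nat. exp_L n
        - ( 3 / pi\<^sup>2 * (harm (n - 1))\<^sup>2
          + zeta_nat 3 / (zeta_nat 2)\<^sup>2 * harm (n - 1)
          + (zeta_nat 3)\<^sup>2 / (zeta_nat 2) ^ 3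
          + 1 / 10
          - 3 / pi\<^sup>2 * Polygamma 1 (real n)
          + (\<Sum>i = 1..N. Gamma (\<bar>neg_root i\<bar> + 1) / ((\<bar>neg_root i\<bar> + 1) * Polygamma 1 (neg_root i))
                          * (Gamma (real n) / Gamma (real n + \<bar>neg_root i\<bar> + 1)))))
     \<in> O(\<lambda>n. real n powr (- 1 - \<bar>neg_root (N + 1)\<bar>))"
    using exp_L_expansion unfolding L_main_def L_term_def by blast
next
  \<comment> \<open>The case N = 0, weakened to an error O(1/n), is enough here.\<close>
  have "(\<lambda>n. exp_L n - L_main n) \<in> O(\<lambda>n. real n powr (- 1 - \<bar>neg_root 1\<bar>))"
    using exp_L_expansion[of 0] by simp
  also have "(\<lambda>n. real n powr (- 1 - \<bar>neg_root 1\<bar>)) \<in> O(\<lambda>n. real n powr - 1)"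
  proof (rule bigoI[of _ 1], rule eventually_mono[OF eventually_ge_at_top[of 1]])
    fix n :: nat assume "n \<ge> 1"
    then have "real n powr (- 1 - \<bar>neg_root 1\<bar>) \<le> real n powr - 1" by (intro powr_mono) auto
    then show "norm (real n powr (- 1 - \<bar>neg_root 1\<bar>)) \<le> 1 * norm (real n powr - 1)" by simp
  qed
  also have "(\<lambda>n. real n powr - 1) \<in> O(\<lambda>n. ln (real n) / real n)" by real_asymp
  finally have "(\<lambda>n. (exp_L n - L_main n) + (L_main n - ( 3 / pi\<^sup>2 * (ln (real n))\<^sup>2
          + (zeta_nat 3 / (zeta_nat 2)\<^sup>2 + euler_mascheroni / zeta_nat 2) * ln (real n)
          + ( 3 * euler_mascheroni\<^sup>2 / pi\<^sup>2 + zeta_nat 3 / (zeta_nat 2)\<^sup>2 * euler_mascheroni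
              + (zeta_nat 3)\<^sup>2 / (zeta_nat 2) ^ 3 + 1 / 10)))) \<in> O(\<lambda>n. ln (real n) / real n)"
    by (rule sum_in_bigo(1)[OF _ L_main_bigo])
  then show "(\<lambda>n::nat. exp_L n
        - ( 3 / pi\<^sup>2 * (ln (real n))\<^sup>2
          + (zeta_nat 3 / (zeta_nat 2)\<^sup>2 + euler_mascheroni / zeta_nat 2) * ln (real n)
          + ( 3 * euler_mascheroni\<^sup>2 / pi\<^sup>2 + zeta_nat 3 / (zeta_nat 2)\<^sup>2 * euler_mascheroni
              + (zeta_nat 3)\<^sup>2 / (zeta_nat 2) ^ 3 + 1 / 10)))
     \<in> O(\<lambda>n. ln (real n) / real n)"
    by (simp only: add_diff_eq diff_add_cancel)
qed

end
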